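(* Every hyperhypersimple set $A$ has hard instances, even with respect to $\overline{ic}$; that is, for every hyperhypersimple set $A$ there is a constant $c$ such that $ic(x:A) \geq C(x) - c$ for infinitely many $x$, and there is a constant $c'$ such that $\overline{ic}(x:A) \geq C(x) - c'$ for infinitely many $x$.
   Context: $\mathbb{N}$ is identified with $\{0,1\}^*$ via the canonical (length-lexicographic) bijection, so sets may be viewed as subsets of either. $\{W_e\}_{e\in\mathbb{N}}$ is the standard enumeration of all r.e. sets, and $\overline{A}$ is the complement of $A$. A set $A$ is hyperhypersimple if it is a coinfinite r.e. set and there is no total recursive function $h$ such that the sets $W_{h(0)}, W_{h(1)}, \ldots$ are finite, pairwise disjoint, and all satisfy $W_{h(i)} \cap \overline{A} \neq \emptyset$. $\lambda$ is the empty string, $l(p)$ is the length of $p \in \{0,1\}^*$, $\chi_A$ is the characteristic function of $A$, and $\perp$ is a special symbol ("don't know"). A (possibly partial) function $f : \{0,1\}^* \to \{0,1,\perp\}$ is $A$-consistent if for all $x \in \mathrm{dom}(f)$, $f(x) = \chi_A(x)$ or $f(x) = \perp$. For a partial recursive mapping $V : \{0,1\}^* \times \{0,1\}^* \to \{0,1\}^* \cup \{\perp\}$, $x \in \{0,1\}^*$ and $A \subseteq \{0,1\}^*$, define - $C_V(x) = \min\{ l(p) : V(p,\lambda) = x\}$ (Kolmogorov complexity); - $ic_V(x:A) = \min\{ l(p) : z \mapsto V(p,z)$ is a total $A$-consistent function and $V(p,x) = \chi_A(x)\}$ (instance complexity); - $\overline{ic}_V(x:A)$: the same as $ic_V(x:A)$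 but without requiring that $z \mapsto V(p,z)$ be total; with value $\infty$ if no such $p$ exists. (The output values $0,1$ of $V$ are regarded as the one-letter strings $0,1$.) Fix an optimal partial recursive mapping $U : \{0,1\}^* \times \{0,1\}^* \to \{0,1\}^* \cup \{\perp\}$, i.e., one such that for every partial recursive mapping $V : \{0,1\}^* \times \{0,1\}^* \to \{0,1\}^* \cup \{\perp\}$ there is a constant $d$ with $C_U(x) \leq C_V(x) + d$, $ic_U(x:A) \leq ic_V(x:A) + d$ and $\overline{ic}_U(x:A) \leq \overline{ic}_V(x:A) + d$ for all $x, A$. Write $C$, $ic$, $\overline{ic}$ for $C_U$, $ic_U$, $\overline{ic}_U$. *)

theory Defs
  imports Main "HOL-Library.Nat_Bijection" "HOL-Library.Extended_Nat"
begin

section \<open>Partial recursive functions on the natural numbers\<close>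

text \<open>Programs for the partial recursive functions: zero, successor, projections, composition,
  primitive recursion and unbounded minimisation.  Programs carry no arity; a program applied
  to an argument list that does not fit it is simply undefined there.\<close>

datatype recf =
    Zero
  | Succ
  | Proj nat
  | Comp recf "recf list"
  | Prim recf recf
  | Mu recf

text \<open>\<open>evals p xs y\<close>: the program \<open>p\<close> halts on the arguments \<open>xs\<close> with value \<open>y\<close>.
  In \<open>Mu\<close> all values at smaller arguments must be defined and nonzero.\<close>

inductive evals :: "recf \<Rightarrow> nat list \<Rightarrow> nat \<Rightarrow> bool" where
  Zero: "evals Zero xs 0"
| Succ: "evals Succ [x] (Suc x)"
| Proj: "i < length xs \<Longrightarrow> evals (Proj i) xs (xs ! i)"
| Comp: "list_all2 (\<lambda>g y. evals g xs y) gs ys \<Longrightarrow> evals f ys z \<Longrightarrow> evals (Comp f gs) xs z"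
| Prim_0: "evals f xs y \<Longrightarrow> evals (Prim f g) (0 # xs) y"
| Prim_Suc: "evals (Prim f g) (n # xs) y \<Longrightarrow> evals g (n # y # xs) z
    \<Longrightarrow> evals (Prim f g) (Suc n # xs) z"
| Mu: "evals f (n # xs) 0 \<Longrightarrow> (\<And>m. m < n \<Longrightarrow> \<exists>k. evals f (m # xs) (Suc k))
    \<Longrightarrow> evals (Mu f) xs n"

inductive_cases evals_ZeroE: "evals Zero xs y"
inductive_cases evals_SuccE: "evals Succ xs y"
inductive_cases evals_ProjE: "evals (Proj i) xs y"
inductive_cases evals_CompE: "evals (Comp f gs) xs y"
inductive_cases evals_Prim_0E: "evals (Prim f g) (0 # xs) y"
inductive_cases evals_Prim_SucE: "evals (Prim f g) (Suc n # xs) y"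
inductive_cases evals_MuE: "evals (Mu f) xs y"

lemma evals_deterministic:
  assumes "evals p xs y" and "evals p xs y'"
  shows "y = y'"
  using assms
proof (induction arbitrary: y' rule: evals.induct)
  case (Zero xs)
  then show ?case by (auto elim: evals_ZeroE)
next
  case (Succ x)
  then show ?case by (auto elim: evals_SuccE)
next
  case (Proj i xs)
  from Proj.prems show ?case by (auto elim: evals_ProjE)
next
  case (Comp xs gs ys f z)
  from Comp.prems obtain ys' where ys': "list_all2 (\<lambda>g y. evals g xs y) gs ys'" "evals f ys' y'"
    by (rule evals_CompE)
  have "ys = ys'"
    using Comp.IH(1) ys'(1) by (auto simp: list_all2_conv_all_nth intro!: nth_equalityI)
  then show ?case using Comp.IH(2) ys'(2) by blast
next
  case (Prim_0 f xs y g)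
  from Prim_0.prems Prim_0.IH show ?case by (blast elim: evals_Prim_0E)
next
  case (Prim_Suc f g n xs y z)
  from Prim_Suc.prems Prim_Suc.IH show ?case by (blast elim: evals_Prim_SucE)
next
  case (Mu f n xs)
  from Mu.prems have 1: "evals f (y' # xs) 0"
    and 2: "\<And>m. m < y' \<Longrightarrow> \<exists>k. evals f (m # xs) (Suc k)"
    by (blast elim: evals_MuE)+
  show ?case
  proof (cases n y' rule: linorder_cases)
    case less
    then show ?thesis using 2 Mu.IH(1) by (metis nat.distinct(1))
  next
    case greater
    then show ?thesis using 1 Mu.IH(2) by (metis nat.distinct(1))
  qed
qed

definition total_recursive :: "(nat \<Rightarrow> nat) \<Rightarrow> bool" where
  "total_recursive h \<longleftrightarrow> (\<exists>p. \<forall>n. evals p [n] (h n))"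

section \<open>The standard enumeration of the r.e. sets\<close>

fun gnum :: "recf \<Rightarrow> nat" where
  "gnum Zero = prod_encode (0, 0)"
| "gnum Succ = prod_encode (1, 0)"
| "gnum (Proj i) = prod_encode (2, i)"
| "gnum (Comp f gs) = prod_encode (3, prod_encode (gnum f, list_encode (map gnum gs)))"
| "gnum (Prim f g) = prod_encode (4, prod_encode (gnum f, gnum g))"
| "gnum (Mu f) = prod_encode (5, gnum f)"

lemma gnum_inject: "gnum p = gnum q \<Longrightarrow> p = q"
proof (induction p arbitrary: q)
  case (Comp f gs)
  then obtain f' gs' where q: "q = Comp f' gs'" "gnum f = gnum f'" "map gnum gs = map gnum gs'"
    by (cases q) (auto simp: prod_encode_eq list_encode_eq)
  have "gs = gs'"
  proof (rule nth_equalityI)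
    show "length gs = length gs'" using q(3) by (rule map_eq_imp_length_eq)
    fix i assume "i < length gs"
    then show "gs ! i = gs' ! i"
      using q(3) \<open>length gs = length gs'\<close> Comp.IH(2) by (metis nth_map nth_mem)
  qed
  then show ?case using q Comp.IH(1) by simp
next
  case (Prim f g)
  then show ?case by (cases q) (auto simp: prod_encode_eq)
next
  case (Mu f)
  then show ?case by (cases q) (auto simp: prod_encode_eq)
qed (case_tac q; auto simp: prod_encode_eq)+

text \<open>\<open>W e\<close> is the domain of the unary function computed by the program with number \<open>e\<close>,
  and empty if \<open>e\<close> is not the number of a program.\<close>

definition W :: "nat \<Rightarrow> nat set" where
  "W e = {x. \<exists>p y. gnum p = e \<and> evals p [x] y}"

definition re_set :: "nat set \<Rightarrow> bool" where
  "re_set A \<longleftrightarrow> (\<exists>e. A = W e)"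

definition hyperhypersimple :: "nat set \<Rightarrow> bool" where
  "hyperhypersimple A \<longleftrightarrow> re_set A \<and> infinite (- A) \<and>
     \<not> (\<exists>h. total_recursive h \<and>
          (\<forall>i. finite (W (h i))) \<and>
          (\<forall>i j. i \<noteq> j \<longrightarrow> W (h i) \<inter> W (h j) = {}) \<and>
          (\<forall>i. W (h i) \<inter> - A \<noteq> {}))"

section \<open>Binary strings\<close>

text \<open>\<open>False\<close> is the letter 0 and \<open>True\<close> the letter 1.\<close>

type_synonym bitstr = "bool list"

text \<open>The length-lexicographic bijection between strings and numbers is bijective base-2
  notation with digit values 1 (letter 0) and 2 (letter 1), most significant letter first;
  see \<open>bij_str_num\<close> and \<open>str_num_mono\<close>.\<close>

definition str_num :: "bitstr \<Rightarrow> nat" where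
  "str_num w = foldl (\<lambda>n b. 2 * n + (if b then 2 else 1)) 0 w"

lemma str_num_Nil [simp]: "str_num [] = 0"
  by (simp add: str_num_def)

lemma str_num_snoc [simp]: "str_num (w @ [b]) = 2 * str_num w + (if b then 2 else 1)"
  by (simp add: str_num_def)

lemma bij_str_num: "bij str_num"
proof (rule bijI)
  have "u = v" if "str_num u = str_num v" for u v
    using that
  proof (induction u arbitrary: v rule: rev_induct)
    case Nil
    then show ?case by (cases v rule: rev_cases) (auto split: if_splits)
  next
    case (snoc b u)
    then obtain v' c where v: "v = v' @ [c]" by (cases v rule: rev_cases) (auto split: if_splits)
    with snoc.prems have "str_num u = str_num v' \<and> b = c"
      by (cases b; cases c; simp; presburger)
    with snoc.IH v show ?case by blast
  qed
  then show "inj str_num" by (rule injI)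
  have "\<exists>w. str_num w = n" for n
  proof (induction n rule: less_induct)
    case (less n)
    show ?case
    proof (cases "n = 0")
      case True
      then show ?thesis by (metis str_num_Nil)
    next
      case False
      define m where "m = (n - 1) div 2"
      have "m < n" using False by (simp add: m_def)
      then obtain w where w: "str_num w = m" using less by blast
      have "n = 2 * m + 1 \<or> n = 2 * m + 2" using False unfolding m_def by presburger
      then have "str_num (w @ [False]) = n \<or> str_num (w @ [True]) = n" using w by auto
      then show ?thesis by blast
    qed
  qed
  then show "surj str_num" by (metis surjI)
qed

lemma str_num_bounds: "2 ^ length w \<le> str_num w + 1" "str_num w + 1 < 2 ^ (length w + 1)"
  by (induction w rule: rev_induct) auto

lemma str_num_append: "str_num (u @ v) = 2 ^ length v * str_num u + str_num v"
  by (induction v rule: rev_induct) (auto simp: algebra_simps simp flip: append_assoc)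

lemma str_num_mono:
  assumes "(u, v) \<in> lenlex {(False, True)}"
  shows "str_num u < str_num v"
  using assms unfolding lenlex_conv
proof (clarsimp, elim disjE conjE)
  assume "length u < length v"
  then have "(2::nat) ^ (length u + 1) \<le> 2 ^ length v"
    by (intro power_increasing) auto
  then show ?thesis using str_num_bounds(2)[of u] str_num_bounds(1)[of v] by linarith
next
  assume l: "length u = length v" and "(u, v) \<in> lex {(False, True)}"
  then obtain xs us vs where uv: "u = (xs @ [False]) @ us" "v = (xs @ [True]) @ vs"
    by (auto simp: lex_conv)
  with l have "length us = length vs" by simp
  with uv show ?thesis
    using str_num_bounds(2)[of us] str_num_bounds(1)[of vs]
    by (simp only: str_num_append length_append)
      (simp add: algebra_simps str_num_snoc[of "[]", simplified])
qed

section \<open>Kolmogorov complexity and instance complexity\<close>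

text \<open>\<open>{0,1}\<^sup>* \<union> {\<bottom>}\<close>.  A partial mapping into this set has an \<open>answer option\<close> as its value,
  where \<open>None\<close> means undefined, as opposed to the answer \<open>Bot\<close>.\<close>

datatype answer = Str bitstr | Bot

type_synonym mapping = "bitstr \<Rightarrow> bitstr \<Rightarrow> answer option"

fun answer_num :: "answer \<Rightarrow> nat" where
  "answer_num Bot = 0"
| "answer_num (Str w) = Suc (str_num w)"

definition partial_recursive :: "mapping \<Rightarrow> bool" where
  "partial_recursive V \<longleftrightarrow>
     (\<exists>q. \<forall>p z n. evals q [str_num p, str_num z] n \<longleftrightarrow> (\<exists>a. V p z = Some a \<and> answer_num a = n))"

definition chi :: "bitstr set \<Rightarrow> bitstr \<Rightarrow> answer" where
  "chi A x = Str [x \<in> A]"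

definition consistent :: "bitstr set \<Rightarrow> (bitstr \<Rightarrow> answer option) \<Rightarrow> bool" where
  "consistent A f \<longleftrightarrow> (\<forall>x a. f x = Some a \<longrightarrow> a = chi A x \<or> a = Bot)"

text \<open>In \<open>enat\<close> the infimum of a nonempty set is its minimum, and \<open>Inf {} = \<infinity>\<close>.\<close>

definition KC :: "mapping \<Rightarrow> bitstr \<Rightarrow> enat" where
  "KC V x = Inf {enat (length p) | p. V p [] = Some (Str x)}"

definition ic :: "mapping \<Rightarrow> bitstr \<Rightarrow> bitstr set \<Rightarrow> enat" where
  "ic V x A = Inf {enat (length p) | p.
     (\<forall>z. V p z \<noteq> None) \<and> consistent A (V p) \<and> V p x = Some (chi A x)}"

definition ic_bar :: "mapping \<Rightarrow> bitstr \<Rightarrow> bitstr set \<Rightarrow> enat" where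
  "ic_bar V x A = Inf {enat (length p) | p. consistent A (V p) \<and> V p x = Some (chi A x)}"

definition optimal :: "mapping \<Rightarrow> bool" where
  "optimal U \<longleftrightarrow> partial_recursive U \<and>
     (\<forall>V. partial_recursive V \<longrightarrow>
       (\<exists>d::nat. \<forall>x A. KC U x \<le> KC V x + enat d \<and>
                      ic U x A \<le> ic V x A + enat d \<and>
                      ic_bar U x A \<le> ic_bar V x A + enat d))"

end

theory Submission
  imports Defs
begin

text \<open>Suppose that \<open>A\<close> is r.e. and has only finitely many hard instances for each constant.  A short
  program is dead once it answers 0 on an element of \<open>A\<close>, and a living one that answers 0 on \<open>x\<close>
  covers \<open>x\<close>.  Let slots \<open>0, 1, 2, \<dots>\<close> hold distinct candidates from the complement of \<open>A\<close>; a
  candidate that enters \<open>A\<close> is replaced, and this kills all programs that cover it.  Give a description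
  of about \<open>k\<close> bits to the candidate of slot \<open>n\<close> whenever the slots \<open>n, n - 1, n - 2, \<dots>\<close> are covered
  by programs of length at most \<open>k, k - 1, k - 2, \<dots>\<close>.  This happens to \<open>O(2 ^ k)\<close> candidates only, since
  each of the \<open>2 ^ r\<close> programs of length \<open>r\<close> is responsible for at most \<open>k - r + 1\<close> lost descriptions.
  A described candidate outside \<open>A\<close> must, unless it is exceptional, be covered by a program
  shorter than \<open>k\<close>, and so for some \<open>b\<close> every slot \<open>n\<close> ends up covered at level \<open>n + b\<close>.

  Slots are numbered by pairs \<open>(b, j)\<close>, and slot \<open>n = (b, j)\<close> marks its candidate only when all slots
  \<open>i \<le> n\<close> are covered at level \<open>i + b\<close>.  As long as a slot is not covered in this way, the later
  slots with the same \<open>b\<close> cannot use up numbers by marking them, and a slot that is covered loses its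
  candidate finitely often; hence all candidates converge.  For the right \<open>b\<close>, the sets of numbers
  marked by the slots \<open>(b, j)\<close> are finite and disjoint and meet the complement of \<open>A\<close>, so \<open>A\<close> is not
  hyperhypersimple.  The value of \<open>b\<close> is not computable, but the descriptions do not depend on it
  because all \<open>b\<close> are treated at once.\<close>

section \<open>Total recursive functions of several arguments\<close>

text \<open>Arguments are the first \<open>n\<close> entries of an environment, so a variable is
  just \<open>e i\<close> and a body is an ordinary term on which the rules
  \<open>rec_intros\<close> can match. As \<open>p\<close> sees only these entries, \<open>f\<close>
  cannot depend on others.\<close>

definition recfn :: "nat \<Rightarrow> ((nat \<Rightarrow> nat) \<Rightarrow> nat) \<Rightarrow> bool" where
  "recfn n f \<longleftrightarrow> (\<exists>p. \<forall>e. evals p (map e [0..<n]) (f e))"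

definition recpred :: "nat \<Rightarrow> ((nat \<Rightarrow> nat) \<Rightarrow> bool) \<Rightarrow> bool" where
  "recpred n P \<longleftrightarrow> recfn n (\<lambda>e. of_bool (P e))"

named_theorems rec_intros

lemma evals_Comp_map:
  assumes "evals p (map h [0..<m]) y" "\<And>i. i < m \<Longrightarrow> evals (q i) xs (h i)"
  shows "evals (Comp p (map q [0..<m])) xs y"
  using assms by (intro evals.Comp[of _ _ "map h [0..<m]"]) (auto simp: list_all2_conv_all_nth)

text \<open>\<open>h\<close> may be any transformer of environments, so permuting, shifting and
  adding arguments are covered along with substitution.\<close>

lemma recfn_compose:
  assumes "recfn m g" "\<And>i. i < m \<Longrightarrow> recfn n (\<lambda>e. h e i)"
  shows "recfn n (\<lambda>e. g (h e))"
proof -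
  obtain p where p: "\<And>e. evals p (map e [0..<m]) (g e)"
    using assms(1) unfolding recfn_def by blast
  obtain q where q: "\<And>i e. i < m \<Longrightarrow> evals (q i) (map e [0..<n]) (h e i)"
    using assms(2) unfolding recfn_def by metis
  show ?thesis
    unfolding recfn_def
    by (intro exI[of _ "Comp p (map q [0..<m])"] allI evals_Comp_map[OF p] q)
qed

lemma recfn_var [rec_intros]: "i < n \<Longrightarrow> recfn n (\<lambda>e. e i)"
  unfolding recfn_def
  by (rule exI[of _ "Proj i"]) (metis add_0 diff_zero evals.Proj length_map length_upt nth_map_upt)

lemma recfn_Suc [rec_intros]: "recfn n f \<Longrightarrow> recfn n (\<lambda>e. Suc (f e))"
  by (rule recfn_compose[of 1 "\<lambda>e. Suc (e 0)" n "\<lambda>e _. f e"])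
    (auto simp: recfn_def intro!: exI[of _ Succ] evals.Succ)

lemma recfn_const [rec_intros]: "recfn n (\<lambda>e. c)"
proof (induction c)
  case 0
  show ?case unfolding recfn_def by (auto intro!: exI[of _ Zero] evals.Zero)
qed (rule recfn_Suc)

text \<open>This and the next three rules reduce a claim about arbitrary argument terms to plain
  variables, where a defining equation can be unfolded.\<close>

lemma recfn_app1:
  assumes "recfn 1 (\<lambda>e. g (e 0))" "recfn n a"
  shows "recfn n (\<lambda>e. g (a e))"
  using recfn_compose[OF assms(1), of n "\<lambda>e _. a e"] assms(2) by simp

lemma recfn_app2:
  assumes "recfn 2 (\<lambda>e. g (e 0) (e 1))" "recfn n a" "recfn n b"
  shows "recfn n (\<lambda>e. g (a e) (b e))"
proof -
  have "recfn n (\<lambda>e. [a e, b e] ! i)" if "i < 2" for i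
    using that assms(2-) by (auto simp: numeral_2_eq_2 less_Suc_eq)
  then show ?thesis
    using recfn_compose[OF assms(1), of n "\<lambda>e. (!) [a e, b e]"] by simp
qed

lemma recfn_app3:
  assumes "recfn 3 (\<lambda>e. g (e 0) (e 1) (e 2))" "recfn n a" "recfn n b" "recfn n c"
  shows "recfn n (\<lambda>e. g (a e) (b e) (c e))"
proof -
  have "recfn n (\<lambda>e. [a e, b e, c e] ! i)" if "i < 3" for i
    using that assms(2-) by (auto simp: numeral_3_eq_3 less_Suc_eq)
  then show ?thesis
    using recfn_compose[OF assms(1), of n "\<lambda>e. (!) [a e, b e, c e]"] by (simp add: numeral_2_eq_2)
qed

lemma recfn_app4:
  assumes "recfn 4 (\<lambda>e. g (e 0) (e 1) (e 2) (e 3))"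
    "recfn n a" "recfn n b" "recfn n c" "recfn n d"
  shows "recfn n (\<lambda>e. g (a e) (b e) (c e) (d e))"
proof -
  have "recfn n (\<lambda>e. [a e, b e, c e, d e] ! i)" if "i < 4" for i
    using that assms(2-) by (auto simp: eval_nat_numeral less_Suc_eq)
  then show ?thesis
    using recfn_compose[OF assms(1), of n "\<lambda>e. (!) [a e, b e, c e, d e]"]
    by (simp add: eval_nat_numeral)
qed

lemmas recpred_app2 = recfn_app2[where g = "\<lambda>x y. of_bool (P x y)" for P, folded recpred_def]
lemmas recpred_app3 = recfn_app3[where g = "\<lambda>x y z. of_bool (P x y z)" for P, folded recpred_def]
lemmas recpred_app4 = recfn_app4[where g = "\<lambda>x y z w. of_bool (P x y z w)" for P, folded recpred_def]

text \<open>Variables bound by a recursion, a search or a quantifier are appended at the end of the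
  environment; the premise on \<open>fun_upd\<close> says that the body does not look at that position
  other than through the bound variable.\<close>

lemma recfn_front:
  assumes "recfn (Suc n) (\<lambda>e. f (e n) e)" "\<And>i e x. f i (e(n := x)) = f i e"
  shows "\<exists>p. \<forall>e i. evals p (i # map e [0..<n]) (f i e)"
proof -
  \<comment> \<open>\<open>Prim\<close> and \<open>Mu\<close> take the bound variable as first
    argument, the environment has it at position \<open>n\<close>; \<open>h\<close> rotates one
    layout into the other.\<close>
  define h :: "(nat \<Rightarrow> nat) \<Rightarrow> nat \<Rightarrow> nat" where
    "h e i = (if i = n then e 0 else e (Suc i))" for e i
  have "recfn (Suc n) (\<lambda>e. f (h e n) (h e))"
    by (rule recfn_compose[OF assms(1)], case_tac "i = n") (auto simp: h_def intro!: recfn_var)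
  then obtain p where p: "\<And>e. evals p (map e [0..<Suc n]) (f (h e n) (h e))"
    unfolding recfn_def by blast
  have "evals p (i # map e [0..<n]) (f i e)" for e i
  proof -
    define e' where "e' = case_nat i e"
    have "map e' [0..<Suc n] = i # map e [0..<n]"
      by (simp add: e'_def map_upt_Suc del: upt_Suc)
    moreover have "f (h e' n) (h e') = f i e"
    proof -
      \<comment> \<open>The two environments differ at most at \<open>n\<close>, where the body does
        not look.\<close>
      have "(h e')(n := e n) = e" by (auto simp: h_def e'_def)
      then show ?thesis using assms(2)[of i "h e'" "e n"] by (simp add: h_def e'_def)
    qed
    ultimately show ?thesis using p[of e'] by simp
  qed
  then show ?thesis by blast
qed

lemma recfn_front2:
  assumes "recfn (Suc (Suc n)) (\<lambda>e. f (e n) (e (Suc n)) e)"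
    "\<And>i j e x. f i j (e(n := x)) = f i j e" "\<And>i j e x. f i j (e(Suc n := x)) = f i j e"
  shows "\<exists>p. \<forall>e i j. evals p (i # j # map e [0..<n]) (f i j e)"
proof -
  define h :: "(nat \<Rightarrow> nat) \<Rightarrow> nat \<Rightarrow> nat" where
    "h e i = (if i = n then e 0 else if i = Suc n then e (Suc 0) else e (Suc (Suc i)))" for e i
  have "recfn (Suc (Suc n)) (\<lambda>e. f (h e n) (h e (Suc n)) (h e))"
    by (rule recfn_compose[OF assms(1)], case_tac "i = n"; case_tac "i = Suc n")
      (auto simp: h_def intro!: recfn_var)
  then obtain p where p: "\<And>e. evals p (map e [0..<Suc (Suc n)]) (f (h e n) (h e (Suc n)) (h e))"
    unfolding recfn_def by blast
  have "evals p (i # j # map e [0..<n]) (f i j e)" for e i j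
  proof -
    define e' where "e' = case_nat i (case_nat j e)"
    have "map e' [0..<Suc (Suc n)] = i # j # map e [0..<n]"
      by (simp add: e'_def map_upt_Suc del: upt_Suc)
    moreover have "f (h e' n) (h e' (Suc n)) (h e') = f i j e"
    proof -
      have "(h e')(n := e n, Suc n := e (Suc n)) = e" by (auto simp: h_def e'_def)
      then show ?thesis
        using assms(2)[of i j "h e'" "e n"] assms(3)[of i j "(h e')(n := e n)" "e (Suc n)"]
        by (simp add: h_def e'_def)
    qed
    ultimately show ?thesis using p[of e'] by simp
  qed
  then show ?thesis by blast
qed

lemma recfn_call:
  assumes p: "\<And>e i. evals p (i # map e [0..<n]) (f i e)" and "recfn n k"
  shows "recfn n (\<lambda>e. f (k e) e)"
proof -
  obtain q where q: "\<And>e. evals q (map e [0..<n]) (k e)"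
    using assms(2) unfolding recfn_def by blast
  have "evals (Comp p (q # map Proj [0..<n])) (map e [0..<n]) (f (k e) e)" for e
  proof (rule evals.Comp)
    have "evals (Proj i) (map e [0..<n]) (e i)" if "i < n" for i
      using evals.Proj[of i "map e [0..<n]"] that by simp
    then show "list_all2 (\<lambda>g. evals g (map e [0..<n])) (q # map Proj [0..<n]) (k e # map e [0..<n])"
      using q by (auto simp: list_all2_conv_all_nth nth_Cons split: nat.split)
  qed (rule p)
  then show ?thesis unfolding recfn_def by blast
qed

lemma recfn_rec_nat [rec_intros]:
  assumes "recfn n f" "recfn (Suc (Suc n)) (\<lambda>e. g (e n) (e (Suc n)) e)" "recfn n k"
    "\<And>i j e x. g i j (e(n := x)) = g i j e" "\<And>i j e x. g i j (e(Suc n := x)) = g i j e"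
  shows "recfn n (\<lambda>e. rec_nat (f e) (\<lambda>i y. g i y e) (k e))"
proof -
  obtain p where p: "\<And>e. evals p (map e [0..<n]) (f e)"
    using assms(1) unfolding recfn_def by blast
  obtain q where q: "\<And>e i y. evals q (i # y # map e [0..<n]) (g i y e)"
    using recfn_front2[OF assms(2,4,5)] by blast
  have "evals (Prim p q) (i # map e [0..<n]) (rec_nat (f e) (\<lambda>i y. g i y e) i)" for e i
    by (induction i) (auto intro: evals.Prim_0 evals.Prim_Suc p q)
  from recfn_call[OF this assms(3)] show ?thesis .
qed

section \<open>Arithmetic, Boolean connectives, bounded quantifiers and minimisation\<close>

lemma recfn_add [rec_intros]: "recfn n a \<Longrightarrow> recfn n b \<Longrightarrow> recfn n (\<lambda>e. a e + b e)"
proof (rule recfn_app2[where g = "(+)"])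
  have "x + y = rec_nat x (\<lambda>i y. Suc y) y" for x y :: nat by (induction y) auto
  then show "recfn 2 (\<lambda>e. e 0 + e 1)"
    by (simp only:) (intro rec_intros; simp)
qed

lemma recfn_diff [rec_intros]: "recfn n a \<Longrightarrow> recfn n b \<Longrightarrow> recfn n (\<lambda>e. a e - b e)"
proof (rule recfn_app2[where g = "(-)"])
  have pred: "x - 1 = rec_nat 0 (\<lambda>i y. i) x" for x :: nat by (cases x) auto
  have "x - y = rec_nat x (\<lambda>i z. rec_nat 0 (\<lambda>i y. i) z) y" for x y :: nat
    by (induction y) (auto simp flip: pred)
  then show "recfn 2 (\<lambda>e. e 0 - e 1)"
    by (simp only:) (intro rec_intros; simp)
qed

lemma recfn_mult [rec_intros]: "recfn n a \<Longrightarrow> recfn n b \<Longrightarrow> recfn n (\<lambda>e. a e * b e)"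
proof (rule recfn_app2[where g = times])
  have "x * y = rec_nat 0 (\<lambda>i z. z + x) y" for x y :: nat by (induction y) auto
  then show "recfn 2 (\<lambda>e. e 0 * e 1)"
    by (simp only:) (intro rec_intros; simp)
qed

lemma recfn_power [rec_intros]: "recfn n a \<Longrightarrow> recfn n b \<Longrightarrow> recfn n (\<lambda>e. a e ^ b e)"
proof (rule recfn_app2[where g = "(^)"])
  have "x ^ y = rec_nat 1 (\<lambda>i z. z * x) y" for x y :: nat by (induction y) auto
  then show "recfn 2 (\<lambda>e. e 0 ^ e 1)"
    by (simp only:) (intro rec_intros; simp)
qed

lemma recfn_of_bool [rec_intros]: "recpred n P \<Longrightarrow> recfn n (\<lambda>e. of_bool (P e))"
  by (simp add: recpred_def)

lemma recpred_not [rec_intros]: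
  assumes "recpred n P" shows "recpred n (\<lambda>e. \<not> P e)"
proof -
  have "of_bool (\<not> P e) = 1 - (of_bool (P e) :: nat)" for e by simp
  then show ?thesis
    using assms unfolding recpred_def by (simp only:) (intro recfn_diff recfn_const)
qed

lemma recpred_conj [rec_intros]:
  "recpred n P \<Longrightarrow> recpred n Q \<Longrightarrow> recpred n (\<lambda>e. P e \<and> Q e)"
  unfolding recpred_def of_bool_conj by (rule recfn_mult)

lemma recpred_disj [rec_intros]:
  assumes "recpred n P" "recpred n Q" shows "recpred n (\<lambda>e. P e \<or> Q e)"
  using recpred_not[OF recpred_conj[OF recpred_not recpred_not, OF assms]] by simp

lemma recpred_imp [rec_intros]:
  assumes "recpred n P" "recpred n Q" shows "recpred n (\<lambda>e. P e \<longrightarrow> Q e)"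
  unfolding imp_conv_disj using assms by (intro rec_intros)

lemma recpred_le [rec_intros]:
  assumes "recfn n a" "recfn n b" shows "recpred n (\<lambda>e. a e \<le> b e)"
proof -
  have "of_bool (a e \<le> b e) = 1 - (a e - b e)" for e by auto
  then show ?thesis
    using assms unfolding recpred_def by (simp only:) (intro rec_intros)
qed

lemma recpred_less [rec_intros]: "recfn n a \<Longrightarrow> recfn n b \<Longrightarrow> recpred n (\<lambda>e. a e < b e)"
  using recpred_not[OF recpred_le, of n b a] by (simp add: not_le)

lemma recpred_eq [rec_intros]: "recfn n a \<Longrightarrow> recfn n b \<Longrightarrow> recpred n (\<lambda>e. a e = b e)"
  unfolding order_eq_iff by (intro recpred_conj recpred_le)

lemma recfn_if [rec_intros]:
  assumes "recpred n P" "recfn n a" "recfn n b"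
  shows "recfn n (\<lambda>e. if P e then a e else b e)"
proof -
  have "recfn n (\<lambda>e. of_bool (P e) * a e + of_bool (\<not> P e) * b e)"
    using assms by (intro rec_intros)
  moreover have "of_bool (P e) * a e + of_bool (\<not> P e) * b e = (if P e then a e else b e)" for e
    by simp
  ultimately show ?thesis by (simp only:)
qed

text \<open>The sum runs as a \<open>rec_nat\<close> whose accumulator occupies position
  \<open>Suc n\<close>; hence the second condition on \<open>fun_upd\<close>.\<close>

lemma recfn_sum [rec_intros]:
  assumes "recfn (Suc n) (\<lambda>e. g (e n) e)" "recfn n k" "\<And>i e x. g i (e(n := x)) = g i e"
    "\<And>i e x. g i (e(Suc n := x)) = g i e"
  shows "recfn n (\<lambda>e. \<Sum>i<k e. g i e)"
proof -
  have eq: "(\<Sum>i<k. f i) = rec_nat 0 (\<lambda>i y. y + f i) k" for f :: "nat \<Rightarrow> nat" and k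
    by (induction k) auto
  have "recfn (Suc (Suc n)) (\<lambda>e. g (e n) e)"
    using recfn_compose[OF assms(1), of "Suc (Suc n)" "\<lambda>e. e"] by (simp add: recfn_var)
  then show ?thesis
    unfolding eq using assms(2-) by (intro rec_intros) auto
qed


lemma recpred_bex_less [rec_intros]:
  assumes "recpred (Suc n) (\<lambda>e. P (e n) e)" "recfn n k" "\<And>i e x. P i (e(n := x)) = P i e"
    "\<And>i e x. P i (e(Suc n := x)) = P i e"
  shows "recpred n (\<lambda>e. \<exists>i<k e. P i e)"
proof -
  have "(\<exists>i<m. Q i) \<longleftrightarrow> 0 < (\<Sum>i<m. of_bool (Q i) :: nat)" for m :: nat and Q
    by (auto simp: card_gt_0_iff)
  then show ?thesis
    using assms by (simp only:) (intro rec_intros; simp)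
qed

lemma recpred_ball_less [rec_intros]:
  assumes "recpred (Suc n) (\<lambda>e. P (e n) e)" "recfn n k" "\<And>i e x. P i (e(n := x)) = P i e"
    "\<And>i e x. P i (e(Suc n := x)) = P i e"
  shows "recpred n (\<lambda>e. \<forall>i<k e. P i e)"
proof -
  have "recpred n (\<lambda>e. \<not> (\<exists>i<k e. \<not> P i e))"
    using assms by (intro rec_intros; simp)
  then show ?thesis by simp
qed

lemma recpred_bex_le [rec_intros]:
  assumes "recpred (Suc n) (\<lambda>e. P (e n) e)" "recfn n k" "\<And>i e x. P i (e(n := x)) = P i e"
    "\<And>i e x. P i (e(Suc n := x)) = P i e"
  shows "recpred n (\<lambda>e. \<exists>i\<le>k e. P i e)"
  unfolding less_Suc_eq_le[symmetric] using assms by (intro recpred_bex_less recfn_Suc)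

lemma recpred_ball_le [rec_intros]:
  assumes "recpred (Suc n) (\<lambda>e. P (e n) e)" "recfn n k" "\<And>i e x. P i (e(n := x)) = P i e"
    "\<And>i e x. P i (e(Suc n := x)) = P i e"
  shows "recpred n (\<lambda>e. \<forall>i\<le>k e. P i e)"
  unfolding less_Suc_eq_le[symmetric] using assms by (intro recpred_ball_less recfn_Suc)

lemma evals_Mu_iff:
  assumes "\<And>i. evals p (i # xs) (of_bool (\<not> P i))"
  shows "evals (Mu p) xs y \<longleftrightarrow> (\<exists>i. P i) \<and> y = (LEAST i. P i)"
proof
  assume "evals (Mu p) xs y"
  then have "evals p (y # xs) 0" "\<And>m. m < y \<Longrightarrow> \<exists>k. evals p (m # xs) (Suc k)"
    by (blast elim: evals_MuE)+
  then have "P y" "\<And>m. m < y \<Longrightarrow> \<not> P m"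
    using assms by (fastforce dest: evals_deterministic simp: of_bool_def split: if_splits)+
  then show "(\<exists>i. P i) \<and> y = (LEAST i. P i)"
    by (metis (mono_tags, lifting) LeastI_ex Least_le linorder_less_linear not_less)
next
  assume *: "(\<exists>i. P i) \<and> y = (LEAST i. P i)"
  then have "P y" "\<And>m. m < y \<Longrightarrow> \<not> P m"
    by (auto intro: LeastI dest: not_less_Least)
  then show "evals (Mu p) xs y"
    using assms[of y] assms by (intro evals.Mu) (auto, metis of_bool_eq(2) One_nat_def)
qed

lemma recfn_Least [rec_intros]:
  assumes "recpred (Suc n) (\<lambda>e. P (e n) e)" "\<And>i e x. P i (e(n := x)) = P i e" "\<And>e. \<exists>i. P i e"
  shows "recfn n (\<lambda>e. LEAST i. P i e)"
proof -
  have "recfn (Suc n) (\<lambda>e. of_bool (\<not> P (e n) e))"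
    using assms(1) by (intro rec_intros)
  then obtain p where p: "\<And>e i. evals p (i # map e [0..<n]) (of_bool (\<not> P i e))"
    using recfn_front[of n "\<lambda>i e. of_bool (\<not> P i e)"] assms(2) by auto
  show ?thesis
    unfolding recfn_def
    by (rule exI[of _ "Mu p"]) (simp add: evals_Mu_iff[where P = "\<lambda>i. P i e" for e, OF p] assms(3))
qed

section \<open>Pairing and finite sequences\<close>

lemma recfn_prod_encode [rec_intros]:
  "recfn n a \<Longrightarrow> recfn n b \<Longrightarrow> recfn n (\<lambda>e. prod_encode (a e, b e))"
proof (rule recfn_app2[where g = "\<lambda>x y. prod_encode (x, y)"])
  have "triangle k = (\<Sum>i<Suc k. i)" for k
    by (induction k) auto
  then have "prod_encode (x, y) = (\<Sum>i<Suc (x + y). i) + x" for x y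
    by (simp add: prod_encode_def)
  then show "recfn 2 (\<lambda>e. prod_encode (e 0, e 1))"
    by (simp only:) (intro rec_intros; simp)
qed

lemma recfn_fst_prod_decode [rec_intros]: "recfn n a \<Longrightarrow> recfn n (\<lambda>e. fst (prod_decode (a e)))"
proof (rule recfn_app1[where g = "\<lambda>v. fst (prod_decode v)"])
  have ex: "\<exists>b<Suc v. prod_encode (fst (prod_decode v), b) = v" for v
    by (rule exI[of _ "snd (prod_decode v)"])
      (metis le_imp_less_Suc le_prod_encode_2 prod.collapse prod_decode_inverse)
  \<comment> \<open>Unpairing is a search; components never exceed the code, which bounds the inner
    quantifier.\<close>
  have "fst (prod_decode v) = (LEAST a. \<exists>b<Suc v. prod_encode (a, b) = v)" for v
    by (rule Least_equality[symmetric]) (use ex in auto)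
  then show "recfn 1 (\<lambda>e. fst (prod_decode (e 0)))"
    using ex by (simp only:) (intro rec_intros; (simp; fail)?; blast)
qed

lemma recfn_snd_prod_decode [rec_intros]: "recfn n a \<Longrightarrow> recfn n (\<lambda>e. snd (prod_decode (a e)))"
proof (rule recfn_app1[where g = "\<lambda>v. snd (prod_decode v)"])
  have ex: "prod_encode (fst (prod_decode v), snd (prod_decode v)) = v" for v
    by simp
  have "snd (prod_decode v) = (LEAST b. prod_encode (fst (prod_decode v), b) = v)" for v
    by (rule Least_equality[symmetric]) (simp, metis order_refl prod_encode_inverse snd_conv)
  then show "recfn 1 (\<lambda>e. snd (prod_decode (e 0)))"
    using ex by (simp only:) (intro rec_intros; (simp; fail)?; blast)
qed

text \<open>A number is read as an endless nest of pairs: drop \<open>n\<close> heads and take the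
  next. No length is stored, and by \<open>ex_lookup\<close> every finite initial segment
  occurs.\<close>

definition lookup :: "nat \<Rightarrow> nat \<Rightarrow> nat" where
  "lookup w n = fst (prod_decode (rec_nat w (\<lambda>_ y. snd (prod_decode y)) n))"

lemma ex_lookup: "\<exists>w. \<forall>i<n. lookup w i = f i"
proof (induction n arbitrary: f)
  case (Suc n)
  obtain w where w: "\<And>i. i < n \<Longrightarrow> lookup w i = f (Suc i)"
    using Suc[of "\<lambda>i. f (Suc i)"] by blast
  have "rec_nat (prod_encode (f 0, w)) (\<lambda>_ y. snd (prod_decode y)) (Suc i)
      = rec_nat w (\<lambda>_ y. snd (prod_decode y)) i" for i
    by (induction i) auto
  then have "lookup (prod_encode (f 0, w)) (Suc i) = lookup w i" for i
    by (simp add: lookup_def)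
  moreover have "lookup (prod_encode (f 0, w)) 0 = f 0"
    by (simp add: lookup_def)
  ultimately have "\<forall>i<Suc n. lookup (prod_encode (f 0, w)) i = f i"
    using w by (auto simp: less_Suc_eq_0_disj)
  then show ?case by blast
qed simp

lemma recfn_lookup [rec_intros]:
  "recfn n a \<Longrightarrow> recfn n b \<Longrightarrow> recfn n (\<lambda>e. lookup (a e) (b e))"
  by (rule recfn_app2[where g = lookup], unfold lookup_def) (intro rec_intros; simp)

section \<open>Clocked evaluation and the s-m-n theorem\<close>

text \<open>The value 0 means that no result has appeared by stage \<open>s\<close>, and
  \<open>Suc y\<close> that the result is \<open>y\<close>. A clock is built for each program by
  recursion on its structure, so no universal program has to be coded.\<close>

definition clock :: "recf \<Rightarrow> (nat \<Rightarrow> nat list \<Rightarrow> nat) \<Rightarrow> bool" where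
  "clock p T \<longleftrightarrow> (\<forall>xs y. evals p xs y \<longleftrightarrow> (\<exists>s. T s xs = Suc y)) \<and>
     (\<forall>xs s t. s \<le> t \<longrightarrow> T s xs \<noteq> 0 \<longrightarrow> T t xs = T s xs) \<and>
     (\<forall>n. recfn (Suc n) (\<lambda>e. T (e n) (map e [0..<n])))"

lemma clockI:
  assumes "\<And>xs y. evals p xs y \<Longrightarrow> \<exists>s. T s xs = Suc y"
    "\<And>xs y s. T s xs = Suc y \<Longrightarrow> evals p xs y"
    "\<And>xs s t. s \<le> t \<Longrightarrow> T s xs \<noteq> 0 \<Longrightarrow> T t xs = T s xs"
    "\<And>n. recfn (Suc n) (\<lambda>e. T (e n) (map e [0..<n]))"
  shows "clock p T"
  using assms unfolding clock_def by blast

lemma clock_halts: "clock p T \<Longrightarrow> evals p xs y \<Longrightarrow> \<exists>s. T s xs = Suc y"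
  and clock_sound: "clock p T \<Longrightarrow> T s xs = Suc y \<Longrightarrow> evals p xs y"
  and clock_mono: "clock p T \<Longrightarrow> T s xs \<noteq> 0 \<Longrightarrow> s \<le> t \<Longrightarrow> T t xs = T s xs"
  and clock_recfn: "clock p T \<Longrightarrow> recfn (Suc n) (\<lambda>e. T (e n) (map e [0..<n]))"
  unfolding clock_def by blast+

lemma clock_Zero: "clock Zero (\<lambda>s xs. 1)"
  by (rule clockI) (auto elim: evals_ZeroE intro: evals.Zero recfn_const[where c = "Suc 0"])

lemma clock_Succ: "clock Succ (\<lambda>s xs. case xs of [x] \<Rightarrow> Suc (Suc x) | _ \<Rightarrow> 0)"
proof (rule clockI)
  fix n
  show "recfn (Suc n) (\<lambda>e. case map e [0..<n] of [x] \<Rightarrow> Suc (Suc x) | _ \<Rightarrow> 0)"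
  proof (cases "n = 1")
    case True
    then show ?thesis by (auto intro!: rec_intros)
  next
    case False
    have "(case xs of [x] \<Rightarrow> Suc (Suc x) | _ \<Rightarrow> 0) = 0" if "length xs \<noteq> 1" for xs :: "nat list"
      using that by (auto split: list.split)
    then have "(case map e [0..<n] of [x] \<Rightarrow> Suc (Suc x) | _ \<Rightarrow> 0) = 0" for e
      using False by simp
    then show ?thesis by (simp add: recfn_const)
  qed
qed (auto elim: evals_SuccE intro: evals.Succ split: list.splits)

lemma clock_Proj: "clock (Proj i) (\<lambda>s xs. if i < length xs then Suc (xs ! i) else 0)"
proof (rule clockI)
  fix n
  show "recfn (Suc n) (\<lambda>e. if i < length (map e [0..<n]) then Suc (map e [0..<n] ! i) else 0)"
    by (cases "i < n") (auto intro!: rec_intros)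
qed (auto elim: evals_ProjE intro: evals.Proj split: if_splits)

lemma recpred_ball_list:
  "(\<And>g. g \<in> set gs \<Longrightarrow> recpred n (P g)) \<Longrightarrow> recpred n (\<lambda>e. \<forall>g\<in>set gs. P g e)"
proof (induction gs)
  case Nil
  have "recpred n (\<lambda>e. True)"
    using recpred_eq[OF recfn_const recfn_const, of n 0 0] by simp
  then show ?case by simp
next
  case (Cons g gs)
  then have "recpred n (P g)" "recpred n (\<lambda>e. \<forall>g\<in>set gs. P g e)" by auto
  from recpred_conj[OF this] show ?case by simp
qed

lemma clock_Comp:
  assumes f: "clock f F" and gs: "\<And>g. g \<in> set gs \<Longrightarrow> clock g (G g)"
  shows "clock (Comp f gs)
    (\<lambda>s xs. if \<forall>g\<in>set gs. G g s xs \<noteq> 0 then F s (map (\<lambda>g. G g s xs - 1) gs) else 0)"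
    (is "clock _ ?T")
proof (rule clockI)
  fix xs y assume "evals (Comp f gs) xs y"
  then obtain ys where ys: "list_all2 (\<lambda>g y. evals g xs y) gs ys" "evals f ys y"
    by (rule evals_CompE)
  have "\<forall>g\<in>set gs. \<exists>s. G g s xs \<noteq> 0"
  proof
    fix g assume g: "g \<in> set gs"
    then obtain z where "evals g xs z"
      using ys(1) by (auto simp: list_all2_conv_all_nth in_set_conv_nth)
    then show "\<exists>s. G g s xs \<noteq> 0" using clock_halts[OF gs[OF g]] by (metis Zero_not_Suc)
  qed
  then obtain S where S: "\<And>g. g \<in> set gs \<Longrightarrow> G g (S g) xs \<noteq> 0" by metis
  obtain s0 where s0: "F s0 ys = Suc y" using clock_halts[OF f ys(2)] by blast
  define s where "s = s0 + sum_list (map S gs)"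
  have "S g \<le> s" if "g \<in> set gs" for g
    using that member_le_sum_list[of "S g" "map S gs"] by (auto simp: s_def)
  then have nz: "G g s xs \<noteq> 0" if "g \<in> set gs" for g
    using that S gs clock_mono by metis
  have "map (\<lambda>g. G g s xs - 1) gs = ys"
  proof (rule nth_equalityI)
    show "length (map (\<lambda>g. G g s xs - 1) gs) = length ys"
      using ys(1) by (auto dest: list_all2_lengthD)
    fix i assume "i < length (map (\<lambda>g. G g s xs - 1) gs)"
    then have i: "i < length gs" "gs ! i \<in> set gs" by auto
    obtain z where z: "G (gs ! i) s xs = Suc z" using nz[OF i(2)] not0_implies_Suc by blast
    then have "evals (gs ! i) xs z" using clock_sound gs i(2) by blast
    moreover have "evals (gs ! i) xs (ys ! i)" using ys(1) i by (simp add: list_all2_conv_all_nth)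
    ultimately show "map (\<lambda>g. G g s xs - 1) gs ! i = ys ! i"
      using z i evals_deterministic by auto
  qed
  moreover have "F s ys = Suc y"
    using clock_mono[OF f, of s0 ys s] s0 by (simp add: s_def)
  ultimately show "\<exists>s. ?T s xs = Suc y" using nz by auto
next
  fix xs y s assume T: "?T s xs = Suc y"
  then have nz: "\<And>g. g \<in> set gs \<Longrightarrow> G g s xs \<noteq> 0" by (auto split: if_splits)
  have "evals g xs (G g s xs - 1)" if "g \<in> set gs" for g
    using clock_sound[OF gs[OF that]] nz[OF that] by simp
  then show "evals (Comp f gs) xs y"
    using T clock_sound[OF f]
    by (intro evals.Comp[of _ _ "map (\<lambda>g. G g s xs - 1) gs"])
      (auto simp: list_all2_conv_all_nth split: if_splits)
next
  fix xs and s t :: nat assume st: "s \<le> t" and T: "?T s xs \<noteq> 0"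
  then have "G g s xs \<noteq> 0" if "g \<in> set gs" for g using that by (auto split: if_splits)
  then have eq: "G g t xs = G g s xs" "G g s xs \<noteq> 0" if "g \<in> set gs" for g
    using that clock_mono[OF gs _ st] by blast+
  have "F s (map (\<lambda>g. G g s xs - 1) gs) \<noteq> 0" using T by (simp split: if_splits)
  from clock_mono[OF f this st] show "?T t xs = ?T s xs"
    using eq by (simp cong: map_cong)
next
  fix n
  define m where "m = length gs"
  have G: "recfn (Suc n) (\<lambda>e. G g (e n) (map e [0..<n]))" if "g \<in> set gs" for g
    using that gs clock_recfn by blast
  define h where "h e i = (if i < m then G (gs ! i) (e n) (map e [0..<n]) - 1 else e n)" for e i
  have "recfn (Suc n) (\<lambda>e. F (h e m) (map (h e) [0..<m]))"
  proof (rule recfn_compose[OF clock_recfn[OF f, of m]])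
    fix i assume "i < Suc m"
    show "recfn (Suc n) (\<lambda>e. h e i)"
      by (cases "i < m") (auto simp: h_def m_def simp del: One_nat_def intro!: recfn_diff G rec_intros)
  qed
  moreover have "map (h e) [0..<m] = map (\<lambda>g. G g (e n) (map e [0..<n]) - 1) gs" for e
    by (rule nth_equalityI) (auto simp: h_def m_def)
  moreover have "h e m = e n" for e by (simp add: h_def)
  ultimately have "recfn (Suc n) (\<lambda>e. F (e n) (map (\<lambda>g. G g (e n) (map e [0..<n]) - 1) gs))"
    by simp
  then show "recfn (Suc n) (\<lambda>e. ?T (e n) (map e [0..<n]))"
    by (intro recfn_if recpred_ball_list recpred_not recpred_eq recfn_const G)
qed

lemma evals_Prim_Nil: "\<not> evals (Prim f g) [] y"
proof
  assume "evals (Prim f g) [] y"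
  then show False by (cases rule: evals.cases)
qed

lemma clock_Prim:
  assumes f: "clock f F" and g: "clock g G"
  shows "clock (Prim f g) (\<lambda>s xs. case xs of [] \<Rightarrow> 0 | k # ys \<Rightarrow>
    rec_nat (F s ys) (\<lambda>i z. if z = 0 then 0 else G s (i # (z - 1) # ys)) k)"
    (is "clock _ ?T")
proof -
  define R where
    "R s ys = rec_nat (F s ys) (\<lambda>i z. if z = 0 then 0 else G s (i # (z - 1) # ys))" for s ys
  have R0: "R s ys 0 = F s ys" for s ys by (simp add: R_def)
  have RS: "R s ys (Suc i) = (if R s ys i = 0 then 0 else G s (i # (R s ys i - 1) # ys))" for s ys i
    by (simp add: R_def)
  have mono: "R t ys k = R s ys k" if "R s ys k \<noteq> 0" "s \<le> t" for s t ys k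
    using that
  proof (induction k)
    case 0
    then show ?case using clock_mono[OF f, of s ys t] by (simp add: R0)
  next
    case (Suc k)
    then have "R s ys k \<noteq> 0" by (auto simp: RS split: if_splits)
    moreover from this Suc have "R t ys k = R s ys k" by blast
    ultimately show ?case
      using Suc.prems clock_mono[OF g, of s "k # (R s ys k - 1) # ys" t] by (simp add: RS)
  qed
  have sound: "evals (Prim f g) (k # ys) y" if "R s ys k = Suc y" for s ys k y
    using that
  proof (induction k arbitrary: y)
    case 0
    then show ?case using clock_sound[OF f] by (auto simp: R0 intro: evals.Prim_0)
  next
    case (Suc k)
    then obtain z where z: "R s ys k = Suc z"
      by (metis RS Zero_neq_Suc not0_implies_Suc)
    with Suc have "evals (Prim f g) (k # ys) z" "G s (k # z # ys) = Suc y"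
      by (auto simp: RS)
    then show ?case using clock_sound[OF g] by (blast intro: evals.Prim_Suc)
  qed
  have halts: "\<exists>s. R s ys k = Suc y" if "evals (Prim f g) (k # ys) y" for ys k y
    using that
  proof (induction k arbitrary: y)
    case 0
    then show ?case using clock_halts[OF f] by (auto simp: R0 elim: evals_Prim_0E)
  next
    case (Suc k)
    from Suc.prems obtain z where z: "evals (Prim f g) (k # ys) z" "evals g (k # z # ys) y"
      by (rule evals_Prim_SucE)
    obtain s where s: "R s ys k = Suc z" using Suc.IH[OF z(1)] by blast
    obtain t where t: "G t (k # z # ys) = Suc y" using clock_halts[OF g z(2)] by blast
    have "R (s + t) ys k = Suc z" "G (s + t) (k # z # ys) = Suc y"
      using mono[of s ys k "s + t"] clock_mono[OF g, of t "k # z # ys" "s + t"] s t by auto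
    then have "R (s + t) ys (Suc k) = Suc y" by (simp add: RS)
    then show ?case by blast
  qed
  show ?thesis
    unfolding R_def[symmetric]
  proof (rule clockI)
    fix xs y assume "evals (Prim f g) xs y"
    then show "\<exists>s. (case xs of [] \<Rightarrow> 0 | k # ys \<Rightarrow> R s ys k) = Suc y"
      using halts evals_Prim_Nil by (cases xs) auto
  next
    fix n
    show "recfn (Suc n) (\<lambda>e. case map e [0..<n] of [] \<Rightarrow> 0 | k # ys \<Rightarrow> R (e n) ys k)"
    proof (cases n)
      case 0
      then show ?thesis by (simp add: recfn_const)
    next
      case (Suc m)
      have F: "recfn (Suc (Suc m)) (\<lambda>e. F (e (Suc m)) (map (\<lambda>i. e (Suc i)) [0..<m]))"
        by (rule recfn_compose[OF clock_recfn[OF f, of m], of "Suc (Suc m)" "\<lambda>e i. e (Suc i)"])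
          (auto intro: recfn_var)
      \<comment> \<open>\<open>recfn_rec_nat\<close> at arity \<open>N = Suc (Suc m)\<close> puts
        the loop index at position \<open>N\<close> and the accumulator at \<open>Suc N\<close>; the
        stage stands at \<open>Suc m\<close>.\<close>
      define h where "h N e = case_nat (e N) (case_nat (e (Suc N) - 1) (\<lambda>i. e (Suc i)))"
        for N and e :: "nat \<Rightarrow> nat"
      have "recfn (Suc (Suc (Suc (Suc m))))
          (\<lambda>e. G (h (Suc (Suc m)) e (Suc (Suc m))) (map (h (Suc (Suc m)) e) [0..<Suc (Suc m)]))"
      proof (rule recfn_compose[OF clock_recfn[OF g, of "Suc (Suc m)"]])
        fix i assume "i < Suc (Suc (Suc m))"
        then show "recfn (Suc (Suc (Suc (Suc m)))) (\<lambda>e. h (Suc (Suc m)) e i)"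
          by (cases i; cases "i - 1") (auto simp: h_def simp del: One_nat_def intro!: rec_intros)
      qed
      then have G: "recfn (Suc (Suc (Suc (Suc m)))) (\<lambda>e. G (e (Suc m))
          (e (Suc (Suc m)) # (e (Suc (Suc (Suc m))) - 1) # map (\<lambda>i. e (Suc i)) [0..<m]))"
        by (simp add: h_def map_upt_Suc del: upt_Suc)
      have M: "map (\<lambda>i. if i = j then x else f i) [0..<m] = map f [0..<m]" if "m \<le> j"
        for f :: "nat \<Rightarrow> nat" and j x
        using that by simp
      have "recfn (Suc (Suc m)) (\<lambda>e. R (e (Suc m)) (map (\<lambda>i. e (Suc i)) [0..<m]) (e 0))"
        unfolding R_def
        by (intro recfn_rec_nat) (auto intro!: F G rec_intros simp: M simp del: One_nat_def)
      then show ?thesis by (simp add: Suc map_upt_Suc del: upt_Suc)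
    qed
  qed (auto intro: sound mono split: list.splits)
qed

text \<open>A clock value 1 is the result 0, and at least 2 a defined nonzero result. At most one
  \<open>i\<close> meets the condition, so the sum has at most one nonzero term.\<close>

lemma clock_Mu:
  assumes f: "clock f F"
  shows "clock (Mu f) (\<lambda>s xs. \<Sum>i<s. if F s (i # xs) = 1 \<and> (\<forall>j<i. 2 \<le> F s (j # xs)) then Suc i else 0)"
    (is "clock _ ?T")
proof -
  define Q where "Q s xs i \<longleftrightarrow> F s (i # xs) = 1 \<and> (\<forall>j<i. 2 \<le> F s (j # xs))" for s xs i
  have uniq: "i = j" if "Q s xs i" "Q s xs j" for s xs i j
    using that by (cases i j rule: linorder_cases) (auto simp: Q_def)
  have val: "?T s xs = Suc i" if "Q s xs i" "i < s" for s xs i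
  proof -
    have "?T s xs = (\<Sum>j<s. if j = i then Suc j else 0)"
      unfolding Q_def[symmetric] using that uniq by (intro sum.cong) auto
    then show ?thesis using that(2) by simp
  qed
  have ex: "\<exists>i<s. Q s xs i" if "?T s xs \<noteq> 0" for s xs
    using that by (auto simp: Q_def split: if_splits)
  have Qmono: "Q t xs i" if "Q s xs i" "s \<le> t" for s t xs i
  proof -
    have "F t (j # xs) = F s (j # xs)" if "j \<le> i" for j
    proof (rule clock_mono[OF f _ \<open>s \<le> t\<close>])
      have "j = i \<or> j < i" using that by linarith
      then show "F s (j # xs) \<noteq> 0" using \<open>Q s xs i\<close> by (auto simp: Q_def)
    qed
    then show ?thesis using that(1) by (auto simp: Q_def)
  qed
  have sound: "evals (Mu f) xs i" if "Q s xs i" for s xs i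
  proof (rule evals.Mu)
    show "evals f (i # xs) 0" using that clock_sound[OF f] by (auto simp: Q_def)
    fix j assume "j < i"
    then have "2 \<le> F s (j # xs)" using that by (simp add: Q_def)
    then have "F s (j # xs) = Suc (Suc (F s (j # xs) - 2))" by simp
    then show "\<exists>k. evals f (j # xs) (Suc k)" using clock_sound[OF f] by blast
  qed
  show ?thesis
  proof (rule clockI)
    fix xs y assume "evals (Mu f) xs y"
    then have y: "evals f (y # xs) 0" "\<And>j. j < y \<Longrightarrow> \<exists>k. evals f (j # xs) (Suc k)"
      by (blast elim: evals_MuE)+
    obtain s0 where s0: "F s0 (y # xs) = 1" using clock_halts[OF f y(1)] by auto
    have "\<forall>j\<in>{..<y}. \<exists>s. 2 \<le> F s (j # xs)"
    proof
      fix j assume "j \<in> {..<y}"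
      then obtain k where "evals f (j # xs) (Suc k)" using y(2) by blast
      then obtain s where "F s (j # xs) = Suc (Suc k)" using clock_halts[OF f] by blast
      then show "\<exists>s. 2 \<le> F s (j # xs)" by (intro exI[of _ s]) simp
    qed
    then obtain S where S: "\<And>j. j < y \<Longrightarrow> 2 \<le> F (S j) (j # xs)"
      by (metis lessThan_iff)
    define s where "s = Suc y + s0 + (\<Sum>j<y. S j)"
    have "S j \<le> s" if "j < y" for j
      using that member_le_sum[of j "{..<y}" S] by (simp add: s_def)
    then have "2 \<le> F s (j # xs)" if "j < y" for j
      using that S[OF that] clock_mono[OF f, of "S j" "j # xs" s] by simp
    moreover have "F s (y # xs) = 1"
      using clock_mono[OF f, of s0 "y # xs" s] s0 by (simp add: s_def)
    ultimately have "Q s xs y" "y < s" by (auto simp: Q_def s_def)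
    then show "\<exists>s. ?T s xs = Suc y" by (intro exI[of _ s] val)
  next
    fix xs y s assume T: "?T s xs = Suc y"
    then have "?T s xs \<noteq> 0" by (simp only: nat.distinct not_False_eq_True)
    then obtain i where i: "i < s" "Q s xs i" using ex by blast
    then have "y = i" using T val[OF i(2,1)] by (simp only: nat.inject)
    then show "evals (Mu f) xs y" using sound[OF i(2)] by simp
  next
    fix xs and s t :: nat assume "s \<le> t" "?T s xs \<noteq> 0"
    then obtain i where i: "i < s" "Q s xs i" using ex by blast
    then show "?T t xs = ?T s xs"
      using val[OF i(2,1)] val[OF Qmono[OF i(2) \<open>s \<le> t\<close>]] \<open>s \<le> t\<close> by (simp only: less_le_trans)
  next
    fix n
    have F: "recfn m (\<lambda>e. F (e n) (e i # map e [0..<n]))" if "n < m" "i < m" for m i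
    proof -
      have "recfn m (\<lambda>e. case_nat (e i) e k)" if "k < Suc (Suc n)" for k
        using that \<open>n < m\<close> \<open>i < m\<close> by (cases k) (auto intro: recfn_var)
      with recfn_compose[OF clock_recfn[OF f, of "Suc n"], of m "\<lambda>e. case_nat (e i) e"]
      have "recfn m (\<lambda>e. F (e n) (map (case_nat (e i) e) [0..<Suc n]))"
        by (simp del: upt_Suc)
      then show ?thesis by (simp add: map_upt_Suc del: upt_Suc)
    qed
    show "recfn (Suc n) (\<lambda>e. ?T (e n) (map e [0..<n]))"
      by (intro rec_intros F) auto
  qed
qed

lemma ex_clock: "\<exists>T. clock p T"
proof (induction p)
  case (Comp f gs)
  then obtain F G where "clock f F" "\<And>g. g \<in> set gs \<Longrightarrow> clock g (G g)" by metis
  then show ?case using clock_Comp by blast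
qed (use clock_Zero clock_Succ clock_Proj clock_Prim clock_Mu in blast)+

text \<open>The source of all partial programs below: an unbounded search followed by a total
  function of the least witness.\<close>

lemma ex_partial_search:
  assumes P: "recpred 3 (\<lambda>e. P (e 2) (e 0) (e 1))" and G: "recfn 3 (\<lambda>e. G (e 2) (e 0) (e 1))"
  shows "\<exists>q. \<forall>x y n. evals q [x, y] n \<longleftrightarrow>
    (\<exists>v. P v x y) \<and> n = G (LEAST v. P v x y) x y"
proof -
  have "recfn (Suc 2) (\<lambda>e. of_bool (\<not> P (e 2) (e 0) (e 1)))"
    using P by (intro rec_intros) (simp add: numeral_3_eq_3)
  then obtain p where p: "\<And>e i. evals p (i # map e [0..<2]) (of_bool (\<not> P i (e 0) (e 1)))"
    using recfn_front[of 2 "\<lambda>i e. of_bool (\<not> P i (e 0) (e 1))"] by auto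
  have p: "evals p (i # [x, y]) (of_bool (\<not> P i x y))" for i x y
    using p[of i "(!) [x, y]"] by (simp add: numeral_2_eq_2)
  have "recfn (Suc 2) (\<lambda>e. G (e 2) (e 0) (e 1))" using G by (simp add: numeral_3_eq_3)
  then obtain g where g: "\<And>e i. evals g (i # map e [0..<2]) (G i (e 0) (e 1))"
    using recfn_front[of 2 "\<lambda>i e. G i (e 0) (e 1)"] by auto
  have g: "evals g [i, x, y] (G i x y)" for i x y
    using g[of i "(!) [x, y]"] by (simp add: numeral_2_eq_2)
  have "evals (Comp g [Mu p, Proj 0, Proj 1]) [x, y] n \<longleftrightarrow>
    (\<exists>v. P v x y) \<and> n = G (LEAST v. P v x y) x y" for x y n
  proof
    assume "evals (Comp g [Mu p, Proj 0, Proj 1]) [x, y] n"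
    then obtain ys where ys: "list_all2 (\<lambda>g. evals g [x, y]) [Mu p, Proj 0, Proj 1] ys" "evals g ys n"
      by (rule evals_CompE)
    then obtain a where "evals (Mu p) [x, y] a" "ys = [a, x, y]"
      by (auto simp: list_all2_Cons1 elim!: evals_ProjE)
    then have "(\<exists>v. P v x y) \<and> a = (LEAST v. P v x y)" "evals g [a, x, y] n"
      using ys(2) evals_Mu_iff[of p "[x, y]" "\<lambda>v. P v x y", OF p] by auto
    then show "(\<exists>v. P v x y) \<and> n = G (LEAST v. P v x y) x y"
      using evals_deterministic[OF g] by blast
  next
    assume *: "(\<exists>v. P v x y) \<and> n = G (LEAST v. P v x y) x y"
    then have "evals (Mu p) [x, y] (LEAST v. P v x y)"
      using evals_Mu_iff[of p "[x, y]" "\<lambda>v. P v x y", OF p] by blast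
    moreover have "evals (Proj 0) [x, y] x" "evals (Proj 1) [x, y] y"
      using evals.Proj[of 0 "[x, y]"] evals.Proj[of 1 "[x, y]"] by auto
    ultimately show "evals (Comp g [Mu p, Proj 0, Proj 1]) [x, y] n"
      using * g by (auto intro!: evals.Comp)
  qed
  then show ?thesis by blast
qed

section \<open>The s-m-n theorem for projections\<close>

lemma total_recursive_iff: "total_recursive h \<longleftrightarrow> recfn 1 (\<lambda>e. h (e 0))"
proof -
  have "(\<forall>e. evals p [e 0] (h (e 0))) \<longleftrightarrow> (\<forall>n. evals p [n] (h n))" for p
  proof (intro iffI allI)
    fix n assume "\<forall>e. evals p [e 0] (h (e 0))"
    from this[THEN spec, of "\<lambda>_. n"] show "evals p [n] (h n)" .
  qed simp
  then have "(\<exists>p. \<forall>n. evals p [n] (h n)) \<longleftrightarrow> (\<exists>p. \<forall>e. evals p [e 0] (h (e 0)))"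
    by blast
  moreover have "map e [0..<1] = [e 0]" for e :: "nat \<Rightarrow> nat" by simp
  ultimately show ?thesis unfolding total_recursive_def recfn_def by (simp only:)
qed

primrec const_prog :: "nat \<Rightarrow> recf" where
  "const_prog 0 = Zero"
| "const_prog (Suc n) = Comp Succ [const_prog n]"

lemma evals_const_prog: "evals (const_prog n) xs n"
proof (induction n)
  case (Suc n)
  then show ?case by (auto intro!: evals.Comp[of _ _ "[n]"] evals.Succ)
qed (simp add: evals.Zero)

lemma recfn_gnum_const_prog [rec_intros]: "recfn n a \<Longrightarrow> recfn n (\<lambda>e. gnum (const_prog (a e)))"
proof (rule recfn_app1[where g = "\<lambda>j. gnum (const_prog j)"])
  \<comment> \<open>\<open>Suc (prod_encode (c, 0))\<close> is \<open>list_encode [c]\<close>, and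
    \<open>prod_encode (1, 0)\<close> is the number of \<open>Succ\<close>.\<close>
  have "gnum (const_prog j) = rec_nat (prod_encode (0, 0))
      (\<lambda>_ c. prod_encode (3, prod_encode (prod_encode (1, 0), Suc (prod_encode (c, 0))))) j" for j
    by (induction j) auto
  then show "recfn 1 (\<lambda>e. gnum (const_prog (e 0)))"
    by (simp only:) (intro rec_intros; simp)
qed

text \<open>The parameter \<open>j\<close> is hard-wired by composing one search program with
  \<open>const_prog j\<close>; the number of the composite is recursive in \<open>j\<close>.\<close>

lemma smn_projection:
  assumes P: "recpred 3 (\<lambda>e. P (e 2) (e 0) (e 1))"
  shows "\<exists>h. total_recursive h \<and> (\<forall>j. W (h j) = {x. \<exists>v. P v j x})"
proof -
  obtain q where q: "\<And>x y n. evals q [x, y] n \<longleftrightarrow> (\<exists>v. P v x y) \<and> n = 0"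
    using ex_partial_search[OF P recfn_const] by blast
  define r where "r j = Comp q [const_prog j, Proj 0]" for j
  have ev: "(\<exists>y. evals (r j) [x] y) \<longleftrightarrow> (\<exists>v. P v j x)" for j x
  proof
    assume "\<exists>y. evals (r j) [x] y"
    then obtain ys y where ys: "list_all2 (\<lambda>g. evals g [x]) [const_prog j, Proj 0] ys" "evals q ys y"
      unfolding r_def by (blast elim: evals_CompE)
    then have "ys = [j, x]"
      using evals_deterministic[OF evals_const_prog] by (auto simp: list_all2_Cons1 elim!: evals_ProjE)
    then show "\<exists>v. P v j x" using ys(2) q by blast
  next
    assume "\<exists>v. P v j x"
    then have "evals q [j, x] 0" using q by blast
    moreover have "evals (Proj 0) [x] x" using evals.Proj[of 0 "[x]"] by simp
    ultimately have "evals (r j) [x] 0"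
      unfolding r_def by (auto intro!: evals.Comp[of _ _ "[j, x]"] evals_const_prog)
    then show "\<exists>y. evals (r j) [x] y" by blast
  qed
  have "total_recursive (\<lambda>j. gnum (r j))"
    unfolding total_recursive_iff r_def by simp (intro rec_intros; simp)
  moreover have "W (gnum (r j)) = {x. \<exists>v. P v j x}" for j
  proof -
    have "gnum p = gnum (r j) \<longleftrightarrow> p = r j" for p using gnum_inject by blast
    then show ?thesis using ev by (simp add: W_def)
  qed
  ultimately show ?thesis by (intro exI[of _ "\<lambda>j. gnum (r j)"] conjI allI)
qed

section \<open>The movable candidates\<close>

text \<open>\<open>alive s x\<close> says that \<open>x\<close> has not been enumerated into \<open>A\<close> by stage \<open>s\<close>, and \<open>covers s p x\<close>
  that the program with number \<open>p\<close> has answered 0 on \<open>x\<close> by stage \<open>s\<close>.\<close>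

locale stages =
  fixes alive :: "nat \<Rightarrow> nat \<Rightarrow> bool" and covers :: "nat \<Rightarrow> nat \<Rightarrow> nat \<Rightarrow> bool" and shift :: "nat \<Rightarrow> nat"
  assumes alive_antimono: "s \<le> t \<Longrightarrow> alive t x \<Longrightarrow> alive s x"
    and covers_mono: "s \<le> t \<Longrightarrow> covers s p x \<Longrightarrow> covers t p x"
    and covers_less: "covers s p x \<Longrightarrow> x < s"
    and infinite_alive: "infinite {x. \<forall>s. alive s x}"
begin

text \<open>The bound \<open>y < s\<close> makes this decidable and, by \<open>covers_less\<close>,
  excludes no covered number.\<close>

definition dead :: "nat \<Rightarrow> nat \<Rightarrow> bool" where
  "dead s p \<longleftrightarrow> (\<exists>y<s. covers s p y \<and> \<not> alive s y)"

text \<open>The numbers below \<open>2 ^ Suc k - 1\<close> are those of the strings of length at most \<open>k\<close>.\<close>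

definition cov :: "nat \<Rightarrow> nat \<Rightarrow> nat \<Rightarrow> bool" where
  "cov s k x \<longleftrightarrow> (\<exists>p<2 ^ Suc k - 1. covers s p x \<and> \<not> dead s p)"

text \<open>Slot \<open>n\<close> puts a mark on its candidate when the candidates of all slots \<open>i \<le> n\<close> are covered at
  level \<open>i + shift n\<close>; two slots with the same shift must not mark the same number.  A slot whose
  candidate dies takes away candidates of later slots, but never marked ones.\<close>

definition stair_of :: "(nat \<Rightarrow> nat \<Rightarrow> nat) \<Rightarrow> nat \<Rightarrow> nat \<Rightarrow> nat \<Rightarrow> bool" where
  "stair_of F s n b \<longleftrightarrow> (\<forall>i\<le>n. cov s (i + b) (F s i))"

text \<open>With \<open>m \<le> t\<close> only finitely many marks exist at a stage, so eligible
  numbers never run out and the test is bounded. \<open>marked\<close> has the same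
  restriction.\<close>

definition eligible :: "(nat \<Rightarrow> nat \<Rightarrow> nat) \<Rightarrow> nat \<Rightarrow> nat \<Rightarrow> nat \<Rightarrow> bool" where
  "eligible F s n y \<longleftrightarrow> alive s y \<and>
     \<not> (\<exists>t<s. \<exists>m\<le>t. m \<noteq> n \<and> shift m = shift n \<and> F t m = y \<and> stair_of F t m (shift m)) \<and>
     (\<forall>m<n. F s m \<noteq> y)"

text \<open>A local rule for the value at \<open>(s, n)\<close>. Since \<open>F\<close> is a
  parameter, it can be tested on a coded finite table in place of \<open>slot\<close>.\<close>

definition admissible :: "(nat \<Rightarrow> nat \<Rightarrow> nat) \<Rightarrow> nat \<Rightarrow> nat \<Rightarrow> nat \<Rightarrow> bool" where
  "admissible F s n y \<longleftrightarrow>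
     (if 0 < s \<and> (\<forall>m\<le>n. alive s (F (s - 1) m)) then y = F (s - 1) n
      else eligible F s n y \<and> (\<forall>z<y. \<not> eligible F s n z))"

context
  notes conj_cong [fundef_cong]
begin

text \<open>Calls go to an earlier stage, or to an earlier slot at the same stage;
  \<open>conj_cong\<close> keeps the guards that show this.\<close>

function slot :: "nat \<Rightarrow> nat \<Rightarrow> nat" where
  "slot s n =
     (if 0 < s \<and> (\<forall>m\<le>n. alive s (slot (s - 1) m)) then slot (s - 1) n
      else LEAST y. alive s y \<and>
        \<not> (\<exists>t<s. \<exists>m\<le>t. m \<noteq> n \<and> shift m = shift n \<and> slot t m = y \<and>
             (\<forall>i\<le>m. cov t (i + shift m) (slot t i))) \<and>
        (\<forall>m<n. slot s m \<noteq> y))"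
  by pat_completeness auto
termination by (relation "measures [fst, snd]") auto

end

declare slot.simps [simp del]

abbreviation "stair \<equiv> stair_of slot"

section \<open>Elementary properties of programs and slots\<close>

lemma dead_mono: "s \<le> t \<Longrightarrow> dead s p \<Longrightarrow> dead t p"
  unfolding dead_def using alive_antimono covers_mono by (meson less_le_trans)

lemma cov_alive: "cov s k x \<Longrightarrow> alive s x"
  unfolding cov_def dead_def using covers_less by blast

lemma cov_lost:
  assumes "cov s k x" "\<not> cov t k x" "s \<le> t"
  shows "\<exists>p<2 ^ Suc k - 1. \<not> dead s p \<and> dead t p"
  using assms covers_mono unfolding cov_def by blast

lemma ex_alive_notin: "finite K \<Longrightarrow> \<exists>a. (\<forall>s. alive s a) \<and> a \<notin> K"
  using finite_subset[of "{x. \<forall>s. alive s x}" K] infinite_alive by blast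

lemma ex_eligible: "\<exists>y. eligible slot s n y"
proof -
  have "finite ((\<lambda>(t, m). slot t m) ` ({..s} \<times> {..s}) \<union> slot s ` {..<n})" by simp
  then obtain y where y: "\<forall>s. alive s y"
    "y \<notin> (\<lambda>(t, m). slot t m) ` ({..s} \<times> {..s}) \<union> slot s ` {..<n}"
    using ex_alive_notin by blast
  then have "eligible slot s n y" unfolding eligible_def by force
  then show ?thesis ..
qed

lemma slot_eq:
  "slot s n = (if 0 < s \<and> (\<forall>m\<le>n. alive s (slot (s - 1) m)) then slot (s - 1) n
     else LEAST y. eligible slot s n y)"
  unfolding eligible_def[abs_def] stair_of_def by (subst slot.simps) (rule refl)

lemma admissible_slot: "admissible slot s n (slot s n)"
proof (cases "0 < s \<and> (\<forall>m\<le>n. alive s (slot (s - 1) m))")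
  case True
  have "slot s n = slot (s - 1) n" by (subst slot_eq) (rule if_P[OF True])
  then show ?thesis unfolding admissible_def if_P[OF True] .
next
  case False
  have eq: "slot s n = (LEAST y. eligible slot s n y)" by (subst slot_eq) (rule if_not_P[OF False])
  have "eligible slot s n (slot s n)" unfolding eq by (rule LeastI_ex[OF ex_eligible])
  moreover have "\<forall>z<slot s n. \<not> eligible slot s n z" unfolding eq by (blast dest: not_less_Least)
  ultimately show ?thesis unfolding admissible_def if_not_P[OF False] ..
qed

lemma alive_slot: "alive s (slot s n)"
  using admissible_slot[of s n] by (auto simp: admissible_def eligible_def split: if_splits)

lemma slot_keep:
  "(\<And>m. m \<le> n \<Longrightarrow> alive (Suc s) (slot s m)) \<Longrightarrow> slot (Suc s) n = slot s n"
  by (simp add: slot_eq[of "Suc s" n])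

lemma slot_distinct: "m < n \<Longrightarrow> slot s m \<noteq> slot s n"
proof (induction s)
  case 0
  then show ?case using admissible_slot[of 0 n] by (auto simp: admissible_def eligible_def)
next
  case (Suc s)
  show ?case
  proof (cases "\<forall>i\<le>n. alive (Suc s) (slot s i)")
    case True
    then show ?thesis using Suc by (simp add: slot_keep)
  next
    case False
    then show ?thesis
      using admissible_slot[of "Suc s" n] Suc.prems
      by (auto simp: admissible_def eligible_def split: if_splits)
  qed
qed

text \<open>A coverage that keeps getting lost uses up the finitely many short programs.\<close>

lemma finite_cov_lost: "finite {t. cov t k (f t) \<and> \<not> cov (Suc t) k (f t)}" (is "finite ?T")
proof -
  have "\<forall>t\<in>?T. \<exists>p<2 ^ Suc k - 1. \<not> dead t p \<and> dead (Suc t) p"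
  proof
    fix t assume "t \<in> ?T"
    then show "\<exists>p<2 ^ Suc k - 1. \<not> dead t p \<and> dead (Suc t) p"
      using cov_lost[of t k "f t" "Suc t"] by simp
  qed
  then obtain q where q: "\<And>t. t \<in> ?T \<Longrightarrow> q t < 2 ^ Suc k - 1 \<and> \<not> dead t (q t) \<and> dead (Suc t) (q t)"
    by metis
  have "q t \<noteq> q u" if "t \<in> ?T" "u \<in> ?T" "t < u" for t u
    using q[OF that(1)] q[OF that(2)] dead_mono[of "Suc t" u] that(3) by auto
  then have "inj_on q ?T" by (intro linorder_inj_onI) auto
  moreover have "q ` ?T \<subseteq> {..<2 ^ Suc k - 1}" using q by blast
  ultimately show ?thesis by (meson finite_lessThan inj_on_finite)
qed

text \<open>By induction the earlier slots have settled. If slot \<open>n\<close> is covered at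
  level \<open>n + shift n\<close> late enough, this coverage is never lost again, and a covered
  candidate is alive, hence kept. Otherwise no later slot with the same shift can mark anything any
  more, so some immortal \<open>a\<close> stays eligible; all new choices are at most
  \<open>a\<close>, and an abandoned candidate is dead and never returns.\<close>

lemma slot_converges: "\<exists>s0. \<forall>s\<ge>s0. slot s n = slot s0 n"
proof (induction n rule: less_induct)
  case (less n)
  then obtain T where T: "\<And>m s. m < n \<Longrightarrow> T m \<le> s \<Longrightarrow> slot s m = slot (T m) m" by metis
  define s0 where "s0 = (\<Sum>m<n. T m)"
  have "T m \<le> s0" if "m < n" for m
    using that member_le_sum[of m "{..<n}" T] by (simp add: s0_def)
  then have below: "slot s m = slot t m" if "m < n" "s0 \<le> s" "s0 \<le> t" for s t m
    using that T by (metis order_trans)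
  have keep: "slot (Suc s) n = slot s n" if "s0 \<le> s" "alive (Suc s) (slot s n)" for s
  proof (rule slot_keep)
    fix m assume "m \<le> n"
    then consider "m = n" | "m < n" by linarith
    then show "alive (Suc s) (slot s m)"
      using that alive_slot[of "Suc s" m] below[of m "Suc s" s] by cases auto
  qed
  define k where "k = n + shift n"
  have "finite {t. cov t k (slot t n) \<and> \<not> cov (Suc t) k (slot t n)}"
    by (rule finite_cov_lost)
  then obtain s' where s': "\<And>t. s' \<le> t \<Longrightarrow> cov t k (slot t n) \<Longrightarrow> cov (Suc t) k (slot t n)"
    unfolding finite_nat_set_iff_bounded by (metis (mono_tags, lifting) mem_Collect_eq not_less)
  define s1 where "s1 = max s0 s'"
  show ?case
  proof (cases "\<exists>t\<ge>s1. cov t k (slot t n)")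
    case True
    then obtain t where t: "s1 \<le> t" "cov t k (slot t n)" by blast
    have "cov u k (slot u n) \<and> slot u n = slot t n" if "t \<le> u" for u
      using that
    proof (induction u rule: dec_induct)
      case (step u)
      have "s0 \<le> u" "s' \<le> u" using t(1) step.hyps by (auto simp: s1_def)
      then have "cov (Suc u) k (slot u n)" using s' step.IH by blast
      moreover from this have "slot (Suc u) n = slot u n" using keep \<open>s0 \<le> u\<close> cov_alive by blast
      ultimately show ?case using step.IH by simp
    qed (use t in simp)
    then show ?thesis by blast
  next
    case False
    \<comment> \<open>Avoiding \<open>K\<close> puts \<open>a\<close> outside all marks made up to
      stage \<open>s1\<close> and outside the final candidates of the earlier slots.\<close>
    define K where "K = (\<lambda>(t, m). slot t m) ` ({..s1} \<times> {..s1}) \<union> slot s1 ` {..<n}"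
    have "finite K" by (simp add: K_def)
    then obtain a where a: "\<And>s. alive s a" "a \<notin> K" using ex_alive_notin by blast
    have elig: "eligible slot s n a" if "s1 \<le> s" for s
      unfolding eligible_def
    proof (intro conjI notI allI impI)
      fix m assume "m < n" "slot s m = a"
      then show False using a(2) below[of m s s1] that by (auto simp: K_def s1_def)
    next
      assume "\<exists>t<s. \<exists>m\<le>t. m \<noteq> n \<and> shift m = shift n \<and> slot t m = a \<and> stair t m (shift m)"
      then obtain t m where m: "m \<le> t" "m \<noteq> n" "shift m = shift n" "slot t m = a"
        "stair t m (shift m)" by blast
      have "s1 < t" using m(1,4) a(2) by (force simp: K_def)
      \<comment> \<open>An earlier slot holds its final candidate, which lies in \<open>K\<close>;
        and a staircase through a later slot would cover slot \<open>n\<close> at level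
        \<open>k\<close>.\<close>
      have "n < m"
        using m(2,4) a(2) below[of m t s1] \<open>s1 < t\<close> by (force simp: K_def s1_def)
      then have "cov t (n + shift m) (slot t n)"
        using m(5) unfolding stair_of_def by (blast intro: less_imp_le_nat)
      then show False using False m(3) \<open>s1 < t\<close> by (auto simp: k_def)
    qed (rule a(1))
    have change: "slot (Suc s) n \<le> a \<and> \<not> alive (Suc s) (slot s n)"
      if "s1 \<le> s" "slot (Suc s) n \<noteq> slot s n" for s
    proof
      show "\<not> alive (Suc s) (slot s n)" using keep that by (auto simp: s1_def)
      show "slot (Suc s) n \<le> a"
        using admissible_slot[of "Suc s" n] elig[of "Suc s"] that
        by (auto simp: admissible_def not_less[symmetric] split: if_splits)
    qed
    define C where "C = {t. s1 \<le> t \<and> slot (Suc t) n \<noteq> slot t n}"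
    have "finite C"
    proof (cases "C = {}")
      \<comment> \<open>The value held before the first change may exceed \<open>a\<close>, so the
        bound is claimed only after a change \<open>t0\<close>.\<close>
      case False
      then obtain t0 where t0: "t0 \<in> C" by blast
      have le: "slot t n \<le> a" if "t0 < t" for t
        using that
      proof (induction t)
        case (Suc t)
        show ?case
        proof (cases "slot (Suc t) n = slot t n")
          case True
          then show ?thesis using Suc t0 change[of t0] by (cases "t = t0") (auto simp: C_def)
        next
          case False
          then show ?thesis using Suc t0 change[of t] by (simp add: C_def)
        qed
      qed simp
      have "slot t n \<noteq> slot u n" if "t \<in> C" "u \<in> C" "t < u" for t u
        using that change[of t] alive_slot[of u n] alive_antimono[of "Suc t" u]
        by (auto simp: C_def)
      then have "inj_on (\<lambda>t. slot t n) (C \<inter> {t0<..})"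
        by (intro linorder_inj_onI) auto
      moreover have "(\<lambda>t. slot t n) ` (C \<inter> {t0<..}) \<subseteq> {..a}" using le by auto
      ultimately have "finite (C \<inter> {t0<..})" by (meson finite_atMost inj_on_finite)
      moreover have "C \<subseteq> C \<inter> {t0<..} \<union> {..t0}" by auto
      ultimately show ?thesis by (meson finite_Un finite_atMost finite_subset)
    qed simp
    then obtain s'' where s'': "\<And>t. t \<in> C \<Longrightarrow> t < s''"
      unfolding finite_nat_set_iff_bounded by blast
    have "slot u n = slot (max s1 s'') n" if "max s1 s'' \<le> u" for u
      using that
    proof (induction u rule: dec_induct)
      case (step u)
      then have "u \<notin> C" using s''[of u] by auto
      then show ?case using step by (auto simp: C_def)
    qed simp
    then show ?thesis by blast
  qed
qed

section \<open>Limits of the slots and the count of described numbers\<close>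

definition limit :: "nat \<Rightarrow> nat" where
  "limit n = slot (SOME s0. \<forall>s\<ge>s0. slot s n = slot s0 n) n"

lemma eventually_slot: "\<exists>s0. \<forall>s\<ge>s0. slot s n = limit n"
  unfolding limit_def using someI_ex[OF slot_converges] by blast

lemma eventually_slots: "\<exists>s0. \<forall>s\<ge>s0. \<forall>m\<le>n. slot s m = limit m"
proof -
  obtain T where T: "\<And>m s. T m \<le> s \<Longrightarrow> slot s m = limit m" using eventually_slot by metis
  have "T m \<le> (\<Sum>m\<le>n. T m)" if "m \<le> n" for m
    using that member_le_sum[of m "{..n}" T] by simp
  then show ?thesis using T by (meson order_trans)
qed

lemma alive_limit: "alive s (limit n)"
proof -
  obtain s0 where "\<And>s. s0 \<le> s \<Longrightarrow> slot s n = limit n" using eventually_slot by blast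
  then show ?thesis using alive_slot[of "max s s0" n] alive_antimono[of s "max s s0"] by simp
qed

lemma inj_limit: "inj limit"
proof (rule linorder_injI)
  fix m n :: nat assume "m < n"
  moreover obtain s where "\<forall>i\<le>n. slot s i = limit i" using eventually_slots by blast
  ultimately show "limit m \<noteq> limit n" using slot_distinct[of m n s] by simp
qed

text \<open>The offset \<open>k - m\<close> makes slot \<open>m\<close> covered at level exactly
  \<open>k\<close>, slot \<open>m - 1\<close> at level \<open>k - 1\<close>, and so on.\<close>

definition described :: "nat \<Rightarrow> nat set" where
  "described k = {slot t m | t m. m \<le> k \<and> stair t m (k - m)}"

text \<open>A described number is either the limit of one of the first \<open>Suc k\<close> slots, or it is charged
  to the first stage at which its staircase breaks.  Taking there the least slot \<open>n\<close> that breaks any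
  staircase and a dying program \<open>p\<close> of least bound covering it, the charged numbers are determined
  by \<open>p\<close> and their distance from \<open>n\<close>; the staircase bounds this distance in terms of the length of
  \<open>p\<close>, which makes the number of charges geometric instead of \<open>k * 2 ^ k\<close>.\<close>

lemma card_described: "finite (described k) \<and> card (described k) < 2 ^ (k + 2)"
proof -
  define charged where "charged v m \<longleftrightarrow>
    m \<le> k \<and> stair v m (k - m) \<and> (\<exists>n\<le>m. \<not> cov (Suc v) (n + (k - m)) (slot v n))" for v m
  have "\<exists>n p. dead (Suc v) p \<and> \<not> dead v p \<and>
      (\<forall>m. charged v m \<longrightarrow> n \<le> m \<and> p < 2 ^ Suc (n + (k - m)) - 1)" if "\<exists>m. charged v m" for v
  proof -
    define breaks where "breaks n \<longleftrightarrow>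
      (\<exists>m. charged v m \<and> n \<le> m \<and> \<not> cov (Suc v) (n + (k - m)) (slot v n))" for n
    define n where "n = (LEAST n. breaks n)"
    have "\<exists>n. breaks n" using that by (auto simp: breaks_def charged_def)
    then have "breaks n" unfolding n_def by (rule LeastI_ex)
    then obtain m1 where m1: "charged v m1" "n \<le> m1" "\<not> cov (Suc v) (n + (k - m1)) (slot v n)"
      by (auto simp: breaks_def)
    have n_le: "n \<le> m" if "charged v m" for m
    proof -
      from that obtain i where "i \<le> m" "\<not> cov (Suc v) (i + (k - m)) (slot v i)"
        by (auto simp: charged_def)
      then have "breaks i" using that by (auto simp: breaks_def)
      then show ?thesis using \<open>i \<le> m\<close> unfolding n_def by (meson Least_le order_trans)
    qed
    \<comment> \<open>The level \<open>n + (k - m)\<close> is lowest for the largest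
      \<open>m\<close>. A program taken from that staircase is below the bounds of all charged ones,
      and it dies because the staircase of \<open>m1\<close> breaks at \<open>n\<close>.\<close>
    define m2 where "m2 = Max {m. charged v m}"
    have fin: "finite {m. charged v m}"
      by (rule finite_subset[of _ "{..k}"]) (auto simp: charged_def)
    have m2: "charged v m2" using Max_in[OF fin] that by (auto simp: m2_def)
    have le_m2: "m \<le> m2" if "charged v m" for m
      using Max_ge[OF fin, of m] that by (simp add: m2_def)
    have "cov v (n + (k - m2)) (slot v n)"
      using m2 n_le[OF m2] unfolding charged_def stair_of_def by blast
    then obtain p where p: "p < 2 ^ Suc (n + (k - m2)) - 1" "covers v p (slot v n)" "\<not> dead v p"
      unfolding cov_def by blast
    have less: "p < 2 ^ Suc (n + (k - m)) - 1" if "charged v m" for m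
    proof -
      have "(2::nat) ^ Suc (n + (k - m2)) - 1 \<le> 2 ^ Suc (n + (k - m)) - 1"
        using le_m2[OF that] by (intro diff_le_mono power_increasing) auto
      then show ?thesis using p(1) by linarith
    qed
    have "dead (Suc v) p"
      using m1(3) less[OF m1(1)] covers_mono[OF _ p(2), of "Suc v"] by (auto simp: cov_def)
    then show ?thesis using p(3) less n_le by blast
  qed
  then obtain N P where NP: "\<And>v m. charged v m \<Longrightarrow> dead (Suc v) (P v) \<and> \<not> dead v (P v) \<and>
      N v \<le> m \<and> P v < 2 ^ Suc (N v + (k - m)) - 1"
    by metis
  \<comment> \<open>A charge is coded by \<open>i = N v + (k - m)\<close>, the level of the breaking
    slot, and the dying program \<open>p\<close>. The program determines \<open>v\<close> as its
    unique stage of death, and then \<open>m = N v + (k - i)\<close>.\<close>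
  define I where "I = (SIGMA i:{..k}. {..<2 ^ Suc i - 1 :: nat})"
  define f where "f = (\<lambda>(i, p). let v = THE v. \<not> dead v p \<and> dead (Suc v) p in slot v (N v + (k - i)))"
  have charged: "slot v m \<in> f ` I" if c: "charged v m" for v m
  proof (rule image_eqI)
    have "m \<le> k" "N v \<le> m" using c NP[OF c] by (auto simp: charged_def)
    have "(THE u. \<not> dead u (P v) \<and> dead (Suc u) (P v)) = v"
    proof (rule the_equality)
      fix u assume u: "\<not> dead u (P v) \<and> dead (Suc u) (P v)"
      show "u = v"
        using u NP[OF c] dead_mono[of "Suc u" v "P v"] dead_mono[of "Suc v" u "P v"]
        by (cases u v rule: linorder_cases) auto
    qed (use NP[OF c] in blast)
    then show "slot v m = f (N v + (k - m), P v)"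
      using \<open>m \<le> k\<close> \<open>N v \<le> m\<close> by (simp add: f_def Let_def)
    show "(N v + (k - m), P v) \<in> I" using \<open>m \<le> k\<close> NP[OF c] by (auto simp: I_def)
  qed
  have sub: "described k \<subseteq> limit ` {..k} \<union> f ` I"
  proof
    fix x assume "x \<in> described k"
    then obtain t m where m: "m \<le> k" "stair t m (k - m)" "x = slot t m"
      by (auto simp: described_def)
    \<comment> \<open>The candidates are frozen at stage \<open>t\<close>: while they stay covered
      they stay alive, so the slots keep them.\<close>
    define good where "good u \<longleftrightarrow> (\<forall>n\<le>m. cov u (n + (k - m)) (slot t n))" for u
    have same: "\<forall>n\<le>m. slot u n = slot t n" if "t \<le> u" "\<And>u'. t \<le> u' \<Longrightarrow> u' \<le> u \<Longrightarrow> good u'" for u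
      using that
    proof (induction u rule: dec_induct)
      case (step u)
      then have eq: "slot u n = slot t n" if "n \<le> m" for n using that by simp
      have "good (Suc u)" using step.prems step.hyps by simp
      then have "alive (Suc u) (slot t n)" if "n \<le> m" for n
        using that cov_alive unfolding good_def by blast
      then have "slot (Suc u) n = slot u n" if "n \<le> m" for n
        using that eq by (intro slot_keep) simp
      then show ?case using eq by simp
    qed simp
    show "x \<in> limit ` {..k} \<union> f ` I"
    proof (cases "\<forall>u\<ge>t. good u")
      case True
      then have "slot u m = x" if "t \<le> u" for u using same[OF that] m(3) by simp
      moreover obtain s0 where "\<And>s. s0 \<le> s \<Longrightarrow> slot s m = limit m" using eventually_slot by blast
      ultimately have "limit m = x" using max.cobounded1[of s0 t] max.cobounded2[of t s0] by metis
      then show ?thesis using m(1) by blast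
    next
      case False
      then have ex: "\<exists>u. t \<le> u \<and> \<not> good u" by blast
      define u where "u = (LEAST u. t \<le> u \<and> \<not> good u)"
      have u: "t \<le> u" "\<not> good u" using LeastI_ex[OF ex] by (auto simp: u_def)
      have before: "good u'" if "t \<le> u'" "u' < u" for u'
        using that not_less_Least[of u' "\<lambda>u. t \<le> u \<and> \<not> good u"] by (auto simp: u_def)
      have "good t" using m(2) by (simp add: good_def stair_of_def)
      then have "t < u" using u by (metis le_neq_implies_less)
      then obtain v where v: "u = Suc v" "t \<le> v" by (cases u) auto
      have eq: "\<forall>n\<le>m. slot v n = slot t n" using same[OF v(2)] before v(1) by simp
      have "good v" using before v by simp
      then have "charged v m"
        using m(1) u(2) eq v(1) by (auto simp: charged_def stair_of_def good_def)
      then show ?thesis using charged[of v m] eq m(3) by simp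
    qed
  qed
  have "finite I" by (simp add: I_def)
  \<comment> \<open>With the \<open>k + 1\<close> limits this leaves at most
    \<open>2 ^ (k + 2) - 2\<close> numbers.\<close>
  have sum: "(\<Sum>i\<le>k. 2 ^ Suc i - 1 :: nat) + k + 3 = 2 ^ (k + 2)" for k
  proof (induction k)
    case (Suc k)
    have "(1::nat) \<le> 2 ^ (k + 2)" "(2::nat) ^ Suc (Suc k) = 2 ^ (k + 2)"
      "(2::nat) ^ (Suc k + 2) = 2 * 2 ^ (k + 2)" by simp_all
    then show ?case using Suc unfolding sum.atMost_Suc by linarith
  qed simp
  have "card (limit ` {..k} \<union> f ` I) \<le> card (limit ` {..k}) + card (f ` I)" by (rule card_Un_le)
  also have "\<dots> \<le> Suc k + card I"
    using card_image_le[of "{..k}" limit] card_image_le[OF \<open>finite I\<close>, of f]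
    by (intro add_mono) simp_all
  also have "card I = (\<Sum>i\<le>k. 2 ^ Suc i - 1)"
    unfolding I_def by (subst card_SigmaI) (simp_all only: finite_atMost finite_lessThan card_lessThan Ball_def simp_thms)
  also have "Suc k + \<dots> < 2 ^ (k + 2)" using sum[of k] by linarith
  finally have "card (limit ` {..k} \<union> f ` I) < 2 ^ (k + 2)" .
  moreover have fin: "finite (limit ` {..k} \<union> f ` I)" using \<open>finite I\<close> by blast
  ultimately show ?thesis using card_mono[OF fin sub] finite_subset[OF sub fin] by linarith
qed

section \<open>Permanent coverage and a uniform shift\<close>

definition eventually_cov :: "nat \<Rightarrow> nat \<Rightarrow> bool" where
  "eventually_cov k x \<longleftrightarrow> (\<exists>p<2 ^ Suc k - 1. (\<exists>s. covers s p x) \<and> (\<forall>s. \<not> dead s p))"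

lemma eventually_covD: "eventually_cov k x \<Longrightarrow> \<exists>s0. \<forall>s\<ge>s0. cov s k x"
  unfolding eventually_cov_def cov_def using covers_mono by meson

lemma eventually_cov_mono: "k \<le> l \<Longrightarrow> eventually_cov k x \<Longrightarrow> eventually_cov l x"
proof -
  assume "k \<le> l" "eventually_cov k x"
  moreover have "(2::nat) ^ Suc k - 1 \<le> 2 ^ Suc l - 1"
    using \<open>k \<le> l\<close> by (intro diff_le_mono power_increasing) auto
  ultimately show ?thesis unfolding eventually_cov_def by (meson less_le_trans)
qed

lemma eventually_stair:
  assumes "\<And>i. i \<le> n \<Longrightarrow> eventually_cov (i + b) (limit i)"
  shows "\<exists>s0. \<forall>s\<ge>s0. stair s n b \<and> slot s n = limit n"
proof -
  obtain T where T: "\<And>i s. i \<le> n \<Longrightarrow> T i \<le> s \<Longrightarrow> cov s (i + b) (limit i)"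
    using eventually_covD[OF assms] by metis
  obtain s0 where s0: "\<And>s i. s0 \<le> s \<Longrightarrow> i \<le> n \<Longrightarrow> slot s i = limit i"
    using eventually_slots by blast
  have "T i \<le> (\<Sum>m\<le>n. T m)" if "i \<le> n" for i
    using that member_le_sum[of i "{..n}" T] by simp
  then have "stair s n b \<and> slot s n = limit n" if "s0 + (\<Sum>m\<le>n. T m) \<le> s" for s
    using that s0 T unfolding stair_of_def by (metis add_leD1 add_leD2 order_refl order_trans)
  then show ?thesis by blast
qed

text \<open>The exceptional numbers cost a constant only: they raise all the stairs above them.\<close>

lemma ex_uniform_shift:
  assumes "finite E"
    and cov: "\<And>x. (\<And>s. alive s x) \<Longrightarrow> \<exists>k. eventually_cov k x"
    and step: "\<And>x k. x \<notin> E \<Longrightarrow> (\<And>s. alive s x) \<Longrightarrow> x \<in> described k \<Longrightarrow> \<exists>l<k. eventually_cov l x"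
  shows "\<exists>b. \<forall>n. eventually_cov (n + b) (limit n)"
proof -
  obtain K where K: "\<And>n. eventually_cov (K n) (limit n)"
    using cov[OF alive_limit] by metis
  define M where "M = {n. limit n \<in> E}"
  have "finite M"
    using finite_vimageI[OF assms(1) inj_limit] by (simp add: M_def vimage_def)
  \<comment> \<open>The sum dominates the covering level of every exceptional limit, so those slots
    satisfy the claim outright.\<close>
  define b where "b = (\<Sum>n\<in>M. K n)"
  have "eventually_cov (n + b) (limit n)" for n
  proof (induction n rule: less_induct)
    case (less n)
    show ?case
    proof (cases "n \<in> M")
      case True
      then have "K n \<le> n + b"
        using member_le_sum[of n M K] \<open>finite M\<close> by (simp add: b_def)
      then show ?thesis using K eventually_cov_mono by blast
    next
      case False
      define k where "k = (LEAST k. eventually_cov k (limit n))"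
      have k: "eventually_cov k (limit n)" unfolding k_def using K by (rule LeastI)
      show ?thesis
      proof (rule ccontr)
        assume "\<not> ?thesis"
        then have "n + b < k" using k eventually_cov_mono by (meson not_less)
        \<comment> \<open>If the least covering level \<open>k\<close> of \<open>limit n\<close>
          exceeded \<open>n + b\<close>, the lower slots, covered at \<open>i + b\<close>, would
          complete a staircase of offset \<open>k - n\<close>. Then \<open>limit n\<close> would be
          described at level \<open>k\<close>, and so covered at a smaller level.\<close>
        have "eventually_cov (i + (k - n)) (limit i)" if "i \<le> n" for i
        proof (cases "i = n")
          case False
          then have "eventually_cov (i + b) (limit i)" using less that by simp
          then show ?thesis
            using \<open>n + b < k\<close> by (auto intro: eventually_cov_mono[of "i + b"])
        qed (use k \<open>n + b < k\<close> in simp)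
        from eventually_stair[OF this] obtain s where "stair s n (k - n)" "slot s n = limit n"
          by blast
        then have "limit n \<in> described k"
          using \<open>n + b < k\<close> unfolding described_def
          by (intro CollectI exI[of _ s] exI[of _ n]) auto
        then obtain l where "l < k" "eventually_cov l (limit n)"
          using step[of "limit n" k] alive_limit False by (auto simp: M_def)
        then show False using not_less_Least[of l "\<lambda>k. eventually_cov k (limit n)"] by (simp add: k_def)
      qed
    qed
  qed
  then show ?thesis by blast
qed

section \<open>The marked sets\<close>

definition marked :: "nat \<Rightarrow> nat set" where
  "marked n = {slot t n | t. n \<le> t \<and> stair t n (shift n)}"

lemma finite_marked: "finite (marked n)"
proof -
  obtain s0 where "\<And>s. s0 \<le> s \<Longrightarrow> slot s n = limit n" using eventually_slot by blast
  then have "marked n \<subseteq> insert (limit n) ((\<lambda>s. slot s n) ` {..s0})"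
    unfolding marked_def by auto (metis atMost_iff imageI linear)
  then show ?thesis by (meson finite_atMost finite_imageI finite_insert finite_subset)
qed

text \<open>After slot \<open>m\<close> has marked the number, slot \<open>n\<close> cannot choose
  it afresh. A slot that merely keeps it held it one stage before, and going back to stage
  \<open>s\<close> contradicts \<open>slot_distinct\<close>.\<close>

lemma marked_disjoint_aux:
  assumes "m \<noteq> n" "shift m = shift n" "slot s m = slot t n" "s \<le> t"
    "m \<le> s" "stair s m (shift m)"
  shows False
  using assms(4,3)
proof (induction t rule: dec_induct)
  case base
  then show ?case using assms(1) slot_distinct by (metis linorder_neqE_nat)
next
  case (step t)
  show ?case
  proof (cases "\<forall>i\<le>n. alive (Suc t) (slot t i)")
    case True
    then show ?thesis using step by (simp add: slot_keep)
  next
    case False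
    then have "eligible slot (Suc t) n (slot (Suc t) n)"
      using admissible_slot[of "Suc t" n] by (auto simp: admissible_def split: if_splits)
    then show ?thesis
      using assms step.prems step.hyps unfolding eligible_def by (metis le_imp_less_Suc)
  qed
qed

lemma marked_disjoint:
  assumes "m \<noteq> n" "shift m = shift n" shows "marked m \<inter> marked n = {}"
proof -
  have False if "x \<in> marked m" "x \<in> marked n" for x
  proof -
    from that obtain s t where "slot s m = x" "m \<le> s" "stair s m (shift m)"
      "slot t n = x" "n \<le> t" "stair t n (shift n)" by (auto simp: marked_def)
    then show False
      using marked_disjoint_aux[of m n s t] marked_disjoint_aux[of n m t s] assms
      by (cases "s \<le> t") auto
  qed
  then show ?thesis by blast
qed

lemma limit_marked:
  assumes "\<And>i. eventually_cov (i + shift n) (limit i)"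
  shows "limit n \<in> marked n"
proof -
  obtain s0 where "\<forall>s\<ge>s0. stair s n (shift n) \<and> slot s n = limit n"
    using eventually_stair[OF assms] by blast
  then have "stair (max s0 n) n (shift n)" "slot (max s0 n) n = limit n" by auto
  then show ?thesis unfolding marked_def by (metis (mono_tags, lifting) CollectI max.cobounded2)
qed

end

section \<open>The machine that describes the candidates\<close>

context stages
begin

text \<open>The rule at \<open>(s, n)\<close> reads only earlier stages and, at stage
  \<open>s\<close>, earlier slots; in all cases inside the square of side \<open>M\<close>.\<close>

lemma admissible_cong:
  assumes "s \<le> M" "n \<le> M" "\<And>t m. t < s \<Longrightarrow> m \<le> M \<Longrightarrow> F t m = slot t m"
    "\<And>m. m < n \<Longrightarrow> F s m = slot s m"
  shows "admissible F s n y \<longleftrightarrow> admissible slot s n y"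
proof -
  have "stair_of F t m b \<longleftrightarrow> stair t m b" if "t < s" "m \<le> t" for t m b
    using that assms(1,3) unfolding stair_of_def by (metis less_imp_le_nat order_trans)
  moreover have "F t m = slot t m" if "t < s" "m \<le> t" for t m
    using that assms(1) by (intro assms(3)) auto
  ultimately have "(\<exists>t<s. \<exists>m\<le>t. m \<noteq> n \<and> shift m = shift n \<and> F t m = y \<and> stair_of F t m (shift m))
      \<longleftrightarrow> (\<exists>t<s. \<exists>m\<le>t. m \<noteq> n \<and> shift m = shift n \<and> slot t m = y \<and> stair t m (shift m))" for y
    by (auto cong: conj_cong)
  then have "eligible F s n = eligible slot s n"
    unfolding eligible_def[abs_def] using assms(4) by (auto simp: fun_eq_iff)
  moreover have "F (s - 1) m = slot (s - 1) m" if "0 < s" "m \<le> n" for m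
    using that assms(2) by (intro assms(3)) auto
  ultimately show ?thesis unfolding admissible_def by auto
qed

lemma admissible_unique: "admissible slot s n y \<Longrightarrow> y = slot s n"
  using admissible_slot[of s n] unfolding admissible_def
  by (metis linorder_neqE_nat)

end

text \<open>The shift is now the first component of a pair, so every \<open>b\<close> is the shift
  of the infinitely many slots \<open>prod_encode (b, j)\<close>.\<close>

locale recursive_stages = stages alive covers "\<lambda>n. fst (prod_decode n)"
  for alive :: "nat \<Rightarrow> nat \<Rightarrow> bool" and covers :: "nat \<Rightarrow> nat \<Rightarrow> nat \<Rightarrow> bool" +
  assumes recpred_alive2: "recpred 2 (\<lambda>e. alive (e 0) (e 1))"
    and recpred_covers3: "recpred 3 (\<lambda>e. covers (e 0) (e 1) (e 2))"
begin

lemmas recpred_alive = recpred_app2[OF recpred_alive2]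
lemmas recpred_covers = recpred_app3[OF recpred_covers3]

section \<open>Recursiveness of the slots\<close>

lemma recpred_dead: "recfn n a \<Longrightarrow> recfn n b \<Longrightarrow> recpred n (\<lambda>e. dead (a e) (b e))"
  by (rule recpred_app2[where P = dead], unfold dead_def)
    (intro rec_intros recpred_alive recpred_covers; simp)

lemma recpred_cov:
  "recfn n a \<Longrightarrow> recfn n b \<Longrightarrow> recfn n c \<Longrightarrow> recpred n (\<lambda>e. cov (a e) (b e) (c e))"
  by (rule recpred_app3[where P = cov], unfold cov_def)
    (intro rec_intros recpred_dead recpred_covers; simp)

definition history :: "nat \<Rightarrow> nat \<Rightarrow> nat \<Rightarrow> nat" where
  "history w t n = lookup (lookup w t) n"

lemma recfn_history:
  "recfn n a \<Longrightarrow> recfn n b \<Longrightarrow> recfn n c \<Longrightarrow> recfn n (\<lambda>e. history (a e) (b e) (c e))"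
  unfolding history_def by (intro rec_intros)

lemma recpred_stair_of_history:
  "recfn n a \<Longrightarrow> recfn n b \<Longrightarrow> recfn n c \<Longrightarrow> recfn n d \<Longrightarrow>
    recpred n (\<lambda>e. stair_of (history (a e)) (b e) (c e) (d e))"
  by (rule recpred_app4[where P = "\<lambda>w. stair_of (history w)"], unfold stair_of_def)
    (intro rec_intros recpred_cov recfn_history; simp)

lemma recpred_eligible_history:
  "recfn n a \<Longrightarrow> recfn n b \<Longrightarrow> recfn n c \<Longrightarrow> recfn n d \<Longrightarrow>
    recpred n (\<lambda>e. eligible (history (a e)) (b e) (c e) (d e))"
  by (rule recpred_app4[where P = "\<lambda>w. eligible (history w)"], unfold eligible_def)
    (intro rec_intros recpred_alive recpred_stair_of_history recfn_history; simp)

lemma recpred_admissible_history: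
  assumes "recfn n a" "recfn n b" "recfn n c" "recfn n d"
  shows "recpred n (\<lambda>e. admissible (history (a e)) (b e) (c e) (d e))"
proof (rule recpred_app4[where P = "\<lambda>w. admissible (history w)", OF _ assms])
  have "admissible F s n y \<longleftrightarrow>
      ((0 < s \<and> (\<forall>m\<le>n. alive s (F (s - 1) m))) \<and> y = F (s - 1) n \<or>
       \<not> (0 < s \<and> (\<forall>m\<le>n. alive s (F (s - 1) m))) \<and> eligible F s n y \<and> (\<forall>z<y. \<not> eligible F s n z))"
    for F s n y
    unfolding admissible_def by (rule if_bool_eq_disj)
  then show "recpred 4 (\<lambda>e. admissible (history (e 0)) (e 1) (e 2) (e 3))"
    by (simp only:) (intro rec_intros recpred_alive recpred_eligible_history recfn_history; simp)
qed

definition is_history :: "nat \<Rightarrow> nat \<Rightarrow> bool" where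
  "is_history M w \<longleftrightarrow> (\<forall>t\<le>M. \<forall>n\<le>M. admissible (history w) t n (history w t n))"

lemma recpred_is_history: "recfn n a \<Longrightarrow> recfn n b \<Longrightarrow> recpred n (\<lambda>e. is_history (a e) (b e))"
  by (rule recpred_app2[where P = is_history], unfold is_history_def)
    (intro rec_intros recpred_admissible_history recfn_history; simp)

lemma ex_history: "\<exists>w. is_history M w"
proof -
  obtain v where v: "\<And>t n. n < Suc M \<Longrightarrow> lookup (v t) n = slot t n"
    using ex_lookup[of "Suc M" "slot t" for t] by metis
  obtain w where "\<forall>t<Suc M. lookup w t = v t" using ex_lookup by blast
  then have w: "history w t n = slot t n" if "t \<le> M" "n \<le> M" for t n
    using v that by (simp add: history_def)
  have "admissible (history w) t n (history w t n)" if "t \<le> M" "n \<le> M" for t n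
    using that admissible_slot[of t n] w admissible_cong[of t M n "history w"] by simp
  then show ?thesis unfolding is_history_def by blast
qed

text \<open>Induction on the stage and, inside it, on the slot: the rule has a unique solution given
  the values before it.\<close>

lemma history_slot:
  assumes "is_history M w"
  shows "t \<le> M \<Longrightarrow> n \<le> M \<Longrightarrow> history w t n = slot t n"
proof (induction t arbitrary: n rule: less_induct)
  case (less t)
  note IH_t = less.IH and t = less.prems(1)
  show ?case
    using \<open>n \<le> M\<close>
  proof (induction n rule: less_induct)
    case (less n)
    have "admissible (history w) t n (history w t n)"
      using assms less.prems t by (simp add: is_history_def)
    moreover have "admissible (history w) t n y \<longleftrightarrow> admissible slot t n y" for y
      by (rule admissible_cong[of t M n]) (use t less IH_t in auto)
    ultimately show ?case using admissible_unique by blast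
  qed
qed

text \<open>A search finds some correct table, and all of them agree with \<open>slot\<close>. Side
  \<open>s + n\<close> suffices because the rule reads slots up to the stage number as well as up to
  \<open>n\<close>.\<close>

lemma recfn_slot: "recfn n a \<Longrightarrow> recfn n b \<Longrightarrow> recfn n (\<lambda>e. slot (a e) (b e))"
proof (rule recfn_app2[where g = slot])
  have "slot s n = history (LEAST w. is_history (s + n) w) s n" for s n
    using history_slot[OF LeastI_ex[OF ex_history[of "s + n"]], of s n] by simp
  then show "recfn 2 (\<lambda>e. slot (e 0) (e 1))"
    by (simp only:) (intro rec_intros recfn_history recpred_is_history ex_history; simp)
qed

lemma recpred_stair:
  "recfn n a \<Longrightarrow> recfn n b \<Longrightarrow> recfn n c \<Longrightarrow> recpred n (\<lambda>e. stair (a e) (b e) (c e))"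
  by (rule recpred_app3[where P = stair], unfold stair_of_def)
    (intro rec_intros recpred_cov recfn_slot; simp)

section \<open>Enumeration of the described numbers\<close>

definition event :: "nat \<Rightarrow> nat \<Rightarrow> bool" where
  "event k v \<longleftrightarrow> snd (prod_decode v) \<le> k \<and>
     stair (fst (prod_decode v)) (snd (prod_decode v)) (k - snd (prod_decode v))"

definition event_val :: "nat \<Rightarrow> nat" where
  "event_val v = slot (fst (prod_decode v)) (snd (prod_decode v))"

text \<open>A described number may arise at many pairs of stage and slot; only the least code
  counts, so that \<open>index\<close> lists each number once.\<close>

definition fresh :: "nat \<Rightarrow> nat \<Rightarrow> bool" where
  "fresh k v \<longleftrightarrow> event k v \<and> (\<forall>u<v. event k u \<longrightarrow> event_val u \<noteq> event_val v)"

definition index :: "nat \<Rightarrow> nat \<Rightarrow> nat" where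
  "index k v = (\<Sum>u<v. of_bool (fresh k u))"

lemma recfn_event_val: "recfn n a \<Longrightarrow> recfn n (\<lambda>e. event_val (a e))"
  unfolding event_val_def by (intro rec_intros recfn_slot)

lemma recpred_event: "recfn n a \<Longrightarrow> recfn n b \<Longrightarrow> recpred n (\<lambda>e. event (a e) (b e))"
  unfolding event_def by (intro rec_intros recpred_stair)

lemma recpred_fresh: "recfn n a \<Longrightarrow> recfn n b \<Longrightarrow> recpred n (\<lambda>e. fresh (a e) (b e))"
  by (rule recpred_app2[where P = fresh], unfold fresh_def)
    (intro rec_intros recpred_event recfn_event_val; simp)

lemma recfn_index: "recfn n a \<Longrightarrow> recfn n b \<Longrightarrow> recfn n (\<lambda>e. index (a e) (b e))"
  by (rule recfn_app2[where g = index], unfold index_def)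
    (intro rec_intros recpred_fresh; simp)

text \<open>Different fresh events carry different described numbers, so
  \<open>card_described\<close> bounds their count.\<close>

lemma index_less: "index k v < 2 ^ (k + 2)"
proof -
  have "index k v = card {u. u < v \<and> fresh k u}"
    unfolding index_def by (simp add: Collect_conj_eq lessThan_def)
  also have "\<dots> = card (event_val ` {u. u < v \<and> fresh k u})"
  proof (rule card_image[symmetric], rule linorder_inj_onI)
    fix u u' assume "u < u'" "u \<in> {u. u < v \<and> fresh k u}" "u' \<in> {u. u < v \<and> fresh k u}"
    then show "event_val u \<noteq> event_val u'" by (auto simp: fresh_def)
  qed auto
  also have "\<dots> \<le> card (described k)"
    using card_described[of k]
    by (intro card_mono) (auto simp: fresh_def event_def event_val_def described_def)
  finally show ?thesis using card_described[of k] by linarith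
qed

lemma index_strict_mono: "fresh k u \<Longrightarrow> u < v \<Longrightarrow> index k u < index k v"
  unfolding index_def by (rule sum_strict_mono2[where b = u]) auto

lemma ex_fresh:
  assumes "x \<in> described k" obtains v where "fresh k v" "event_val v = x"
proof -
  obtain t m where "m \<le> k" "stair t m (k - m)" "x = slot t m"
    using assms by (auto simp: described_def)
  then have ex: "event k (prod_encode (t, m)) \<and> event_val (prod_encode (t, m)) = x"
    by (simp add: event_def event_val_def)
  define v where "v = (LEAST v. event k v \<and> event_val v = x)"
  have "event k v \<and> event_val v = x" unfolding v_def by (rule LeastI, rule ex)
  moreover have "\<forall>u<v. \<not> (event k u \<and> event_val u = x)"
    unfolding v_def by (blast dest: not_less_Least)
  ultimately show thesis using that[of v] by (auto simp: fresh_def)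
qed

text \<open>The machine: a program \<open>q @ [False]\<close> with \<open>length q = k + 2\<close> outputs the described
  number of level \<open>k\<close> with index \<open>q\<close>; a program \<open>q @ [True]\<close> answers 0 on \<open>q\<close> and \<open>\<bottom>\<close> elsewhere.\<close>

definition found :: "nat \<Rightarrow> nat \<Rightarrow> bool" where
  "found v p \<longleftrightarrow> (\<exists>r\<le>p. p = 2 * r) \<or>
     (fresh (fst (prod_decode v)) (snd (prod_decode v)) \<and>
      p = 2 * (2 ^ (fst (prod_decode v) + 2) - 1 +
        index (fst (prod_decode v)) (snd (prod_decode v))) + 1)"

text \<open>Values are coded answers: 0 is \<open>Bot\<close> and 2 is the one-letter string 0.
  Appending \<open>True\<close> to a string gives an even code and appending \<open>False\<close> an
  odd one, so parity separates the two kinds of program.\<close>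

definition result :: "nat \<Rightarrow> nat \<Rightarrow> nat \<Rightarrow> nat" where
  "result v p z = (if \<exists>r\<le>p. p = 2 * r then (if p = 2 * z + 2 then 2 else 0)
     else Suc (event_val (snd (prod_decode v))))"

definition num_answer :: "nat \<Rightarrow> answer" where
  "num_answer n = (case n of 0 \<Rightarrow> Bot | Suc m \<Rightarrow> Str (inv str_num m))"

definition machine :: mapping where
  "machine p z = (if \<exists>v. found v (str_num p)
     then Some (num_answer (result (LEAST v. found v (str_num p)) (str_num p) (str_num z)))
     else None)"

lemma answer_num_num_answer: "answer_num (num_answer n) = n"
  by (cases n) (simp_all add: num_answer_def bij_str_num bij_is_surj surj_f_inv_f)

lemma num_answer_Suc_str_num: "num_answer (Suc (str_num w)) = Str w"
  by (simp add: num_answer_def bij_str_num bij_is_inj inv_f_f)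

lemma partial_recursive_machine: "partial_recursive machine"
proof -
  have "recpred 3 (\<lambda>e. found (e 2) (e 0))"
    unfolding found_def by (intro rec_intros recpred_fresh recfn_index; simp)
  moreover have "recfn 3 (\<lambda>e. result (e 2) (e 0) (e 1))"
    unfolding result_def by (intro rec_intros recfn_event_val; simp)
  ultimately obtain q where "\<And>x y n. evals q [x, y] n \<longleftrightarrow>
      (\<exists>v. found v x) \<and> n = result (LEAST v. found v x) x y"
    using ex_partial_search[of "\<lambda>v x y. found v x" result] by auto
  then show ?thesis
    unfolding partial_recursive_def machine_def
    by (intro exI[of _ q]) (auto simp: answer_num_num_answer)
qed

lemma KC_machine_le:
  assumes "str_num w \<in> described k" shows "KC machine w \<le> enat (k + 3)"
proof -
  obtain v where v: "fresh k v" "event_val v = str_num w" using ex_fresh[OF assms] .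
  \<comment> \<open>Codes of strings of length \<open>k + 2\<close> start at
    \<open>2 ^ (k + 2) - 1\<close>; adding an index below \<open>2 ^ (k + 2)\<close> stays within
    that length.\<close>
  obtain q where q: "str_num q = 2 ^ (k + 2) - 1 + index k v"
    using bij_str_num by (metis bij_pointE)
  have pow: "(1::nat) \<le> 2 ^ j" for j by simp
  have pow_less: "i < j" if "(2::nat) ^ i < 2 ^ j" for i j using that by simp
  have len: "length q = k + 2"
  proof -
    have "(2::nat) ^ (k + 3) = 2 * 2 ^ (k + 2)" by (simp add: power_add)
    then have "(2::nat) ^ (k + 2) < 2 ^ (length q + 1)" "(2::nat) ^ length q < 2 ^ (k + 3)"
      using str_num_bounds[of q] q index_less[of k v] pow[of "k + 2"] by linarith+
    then have "k + 2 < length q + 1" "length q < k + 3"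
      by (blast intro: pow_less)+
    then show ?thesis by simp
  qed
  define p where "p = q @ [False]"
  have p: "str_num p = 2 * str_num q + 1" by (simp add: p_def)
  have odd: "\<not> (\<exists>r\<le>str_num p. str_num p = 2 * r)" unfolding p by presburger
  \<comment> \<open>The search has a single witness: the length of \<open>q\<close> determines the
    level, and \<open>index\<close> is strictly increasing along fresh events.\<close>
  have found: "found u (str_num p) \<longleftrightarrow> u = prod_encode (k, v)" for u
  proof
    assume u: "found u (str_num p)"
    define l t where "l = fst (prod_decode u)" and "t = snd (prod_decode u)"
    have lt: "fresh l t" "str_num q = 2 ^ (l + 2) - 1 + index l t"
      using u odd p unfolding found_def l_def t_def by auto
    have "(2::nat) ^ (k + 3) = 2 * 2 ^ (k + 2)" "(2::nat) ^ (l + 3) = 2 * 2 ^ (l + 2)"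
      by (simp_all add: power_add)
    then have "(2::nat) ^ (k + 2) < 2 ^ (l + 3)" "(2::nat) ^ (l + 2) < 2 ^ (k + 3)"
      using lt(2) q index_less[of k v] index_less[of l t] pow[of "k + 2"] pow[of "l + 2"]
      by linarith+
    then have "k + 2 < l + 3" "l + 2 < k + 3"
      by (blast intro: pow_less)+
    then have "l = k" by simp
    moreover from this have "index k t = index k v" 
      using lt(2) q pow[of "k + 2"] unfolding \<open>l = k\<close> by linarith
    then have "t = v"
      using index_strict_mono[of k t v] index_strict_mono[of k v t] v(1) lt(1) \<open>l = k\<close>
      by (cases t v rule: linorder_cases) auto
    ultimately show "u = prod_encode (k, v)" by (metis l_def t_def prod.collapse prod_decode_inverse)
  next
    assume "u = prod_encode (k, v)"
    then show "found u (str_num p)" using v(1) p q by (simp add: found_def)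
  qed
  have "(LEAST u. found u (str_num p)) = prod_encode (k, v)"
    unfolding found by (rule Least_equality) auto
  moreover have "result (prod_encode (k, v)) (str_num p) z = Suc (str_num w)" for z
    unfolding result_def if_not_P[OF odd] using v(2) by simp
  ultimately have "machine p [] = Some (Str w)"
    unfolding machine_def using found num_answer_Suc_str_num by auto
  then have "KC machine w \<le> enat (length p)" unfolding KC_def by (blast intro: Inf_lower)
  then show ?thesis by (simp add: p_def len eval_nat_numeral)
qed

text \<open>This makes \<open>ic_bar\<close> finite outside \<open>A\<close>, so that each immortal
  number is permanently covered at some level.\<close>

lemma ic_bar_machine_le:
  assumes "w \<notin> A" shows "ic_bar machine w A \<le> enat (length w + 1)"
proof -
  define p where "p = w @ [True]"
  have p: "str_num p = 2 * str_num w + 2" by (simp add: p_def)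
  have even: "\<exists>r\<le>str_num p. str_num p = 2 * r"
    unfolding p by (intro exI[of _ "str_num w + 1"]) simp
  have two: "num_answer 2 = Str [False]"
    using num_answer_Suc_str_num[of "[False]"] str_num_snoc[of "[]" False]
    by (simp add: numeral_2_eq_2)
  have "machine p z = Some (if z = w then Str [False] else Bot)" for z
    using even two inj_eq[OF bij_is_inj[OF bij_str_num], of w z]
    unfolding machine_def found_def result_def by (auto simp: p num_answer_def)
  then have "consistent A (machine p)" "machine p w = Some (chi A w)"
    using assms by (auto simp: consistent_def chi_def split: if_splits)
  then have "ic_bar machine w A \<le> enat (length p)" unfolding ic_bar_def by (blast intro: Inf_lower)
  then show ?thesis by (simp add: p_def)
qed

lemma ex_marking_array:
  "\<exists>h. total_recursive h \<and> (\<forall>j. W (h j) = marked (prod_encode (b, j)))"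
proof -
  have "recpred 3 (\<lambda>e. prod_encode (b, e 0) \<le> e 2 \<and> stair (e 2) (prod_encode (b, e 0)) b \<and>
      slot (e 2) (prod_encode (b, e 0)) = e 1)"
    by (intro rec_intros recpred_stair recfn_slot; simp)
  from smn_projection[OF this]
  show ?thesis unfolding marked_def by (auto simp: conj_ac eq_commute)
qed

end

section \<open>Hard instances\<close>

lemma W_program: obtains q where "W e = {x. \<exists>y. evals q [x] y}"
proof (cases "\<exists>p. gnum p = e")
  case True
  then obtain p where p: "gnum p = e" ..
  then have "gnum q = e \<longleftrightarrow> q = p" for q using gnum_inject by blast
  then show thesis using that[of p] by (simp add: W_def)
next
  \<comment> \<open>A number that codes no program gives the empty set, the domain of
    \<open>Proj 1\<close> on one argument.\<close>
  case False
  have "\<not> evals (Proj 1) [x] y" for x y by (auto elim: evals_ProjE)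
  then show thesis using that[of "Proj 1"] False by (simp add: W_def)
qed

lemma answer_num_eq_2_iff: "answer_num a = 2 \<longleftrightarrow> a = Str [False]"
proof (cases a)
  case (Str w)
  have "str_num w = 1 \<longleftrightarrow> w = [False]"
    using inj_eq[OF bij_is_inj[OF bij_str_num], of w "[False]"] str_num_snoc[of "[]" False] by simp
  then show ?thesis using Str by auto
qed simp

lemma hard_instances_ic_bar:
  fixes U :: mapping and A :: "bitstr set"
  assumes U: "optimal U" and A: "hyperhypersimple (str_num ` A)"
  shows "\<exists>c::nat. infinite {x. ic_bar U x A + enat c \<ge> KC U x}"
proof (rule ccontr)
  assume "\<not> ?thesis"
  then have fin: "\<And>c::nat. finite {x. ic_bar U x A + enat c \<ge> KC U x}" by blast
  obtain qA where "str_num ` A = {x. \<exists>y. evals qA [x] y}"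
    using A W_program unfolding hyperhypersimple_def re_set_def by metis
  then have qA: "x \<in> str_num ` A \<longleftrightarrow> (\<exists>y. evals qA [x] y)" for x by blast
  obtain TA where TA: "clock qA TA" using ex_clock by blast
  have A_iff: "x \<in> str_num ` A \<longleftrightarrow> (\<exists>s. TA s [x] \<noteq> 0)" for x
    unfolding qA using clock_halts[OF TA] clock_sound[OF TA] by (metis not0_implies_Suc Zero_not_Suc)
  obtain qU where qU: "\<And>p z n. evals qU [str_num p, str_num z] n \<longleftrightarrow>
      (\<exists>a. U p z = Some a \<and> answer_num a = n)"
    using U unfolding optimal_def partial_recursive_def by blast
  obtain TU where TU: "clock qU TU" using ex_clock by blast
  define alive where "alive s x \<longleftrightarrow> TA s [x] = 0" for s x
  \<comment> \<open>The clock value 3 is \<open>Suc 2\<close>, and 2 is the code of the answer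
    0.\<close>
  define covers where "covers s p x \<longleftrightarrow> x < s \<and> TU s [p, x] = 3" for s p x
  have alive_all: "(\<forall>s. alive s x) \<longleftrightarrow> x \<notin> str_num ` A" for x
    unfolding A_iff alive_def by simp
  then have alive_iff: "(\<forall>s. alive s (str_num w)) \<longleftrightarrow> w \<notin> A" for w
    by (simp only: inj_image_mem_iff[OF bij_is_inj[OF bij_str_num]])
  have covers_U: "(\<exists>s. covers s (str_num p) (str_num z)) \<longleftrightarrow> U p z = Some (Str [False])" for p z
  proof
    assume "\<exists>s. covers s (str_num p) (str_num z)"
    then obtain s where "TU s [str_num p, str_num z] = Suc 2" by (auto simp: covers_def)
    then show "U p z = Some (Str [False])"
      using clock_sound[OF TU] qU answer_num_eq_2_iff by metis
  next
    assume "U p z = Some (Str [False])"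
    then have "evals qU [str_num p, str_num z] 2"
      unfolding qU using answer_num_eq_2_iff by metis
    then obtain s where "TU s [str_num p, str_num z] = Suc 2" using clock_halts[OF TU] by blast
    then have "covers (s + Suc (str_num z)) (str_num p) (str_num z)"
      using clock_mono[OF TU, of s _ "s + Suc (str_num z)"] by (simp add: covers_def)
    then show "\<exists>s. covers s (str_num p) (str_num z)" ..
  qed
  interpret recursive_stages alive covers
  proof
    show "alive s x" if "s \<le> t" "alive t x" for s t x
      using that clock_mono[OF TA, of s "[x]" t] by (auto simp: alive_def)
    show "covers t p x" if "s \<le> t" "covers s p x" for s t p x
      using that clock_mono[OF TU, of s "[p, x]" t] by (auto simp: covers_def)
    show "x < s" if "covers s p x" for s p x using that by (simp add: covers_def)
    have "{x. \<forall>s. alive s x} = - str_num ` A" using alive_all by blast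
    then show "infinite {x. \<forall>s. alive s x}" using A by (simp add: hyperhypersimple_def)
    \<comment> \<open>\<open>clock_recfn\<close> has the stage after the arguments; here it is moved
      to the front.\<close>
    have "recfn 2 (\<lambda>e. TA (e 0) [e 1])"
      using recfn_compose[OF clock_recfn[OF TA, of 1], of 2 "\<lambda>e i. e (1 - i)"]
      by (simp add: recfn_var)
    then show "recpred 2 (\<lambda>e. alive (e 0) (e 1))"
      unfolding alive_def by (intro rec_intros)
    have "recfn 3 (\<lambda>e. TU (e 0) [e 1, e 2])"
      using recfn_compose[OF clock_recfn[OF TU, of 2], of 3 "\<lambda>e i. e ((i + 1) mod 3)"]
      by (simp add: recfn_var numeral_2_eq_2)
    then show "recpred 3 (\<lambda>e. covers (e 0) (e 1) (e 2))"
      unfolding covers_def by (intro rec_intros; simp)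
  qed
  obtain d where KC_le: "\<And>x. KC U x \<le> KC machine x + enat d"
    and ic_le: "\<And>x. ic_bar U x A \<le> ic_bar machine x A + enat d"
    using U partial_recursive_machine unfolding optimal_def by metis
  \<comment> \<open>A consistent program never answers 0 on \<open>A\<close>, so it never dies;
    deciding \<open>w\<close> outside \<open>A\<close> means answering 0 there.\<close>
  have ic_cov: "\<exists>l<k. eventually_cov l (str_num w)" if w: "w \<notin> A" and less: "ic_bar U w A < enat k" for w k
  proof -
    obtain p where p: "consistent A (U p)" "U p w = Some (chi A w)" "length p < k"
      using less unfolding ic_bar_def Inf_less_iff by auto
    have "\<not> dead s (str_num p)" for s
    proof
      assume "dead s (str_num p)"
      then obtain y where y: "covers s (str_num p) y" "\<not> alive s y" by (auto simp: dead_def)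
      obtain z where z: "y = str_num z" using bij_str_num by (metis bij_pointE)
      have "z \<in> A" using alive_iff[of z] y z by blast
      moreover have "U p z = Some (Str [False])" using covers_U y(1) z by blast
      ultimately show False using p(1) by (auto simp: consistent_def chi_def)
    qed
    moreover have "U p w = Some (Str [False])" using p(2) w by (simp add: chi_def)
    moreover have "str_num p < 2 ^ Suc (length p) - 1" using str_num_bounds(2)[of p] by simp
    ultimately have "eventually_cov (length p) (str_num w)"
      using covers_U unfolding eventually_cov_def by blast
    then show ?thesis using p(3) by blast
  qed
  \<comment> \<open>The constant collects the 3 extra bits of \<open>KC_machine_le\<close> and the
    loss \<open>d\<close> of optimality, so that a described number outside \<open>E\<close> at
    level \<open>k\<close> has \<open>ic_bar\<close> below \<open>k\<close>.\<close>
  define E where "E = str_num ` {x. ic_bar U x A + enat (d + 3) \<ge> KC U x}"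
  have "\<exists>b. \<forall>n. eventually_cov (n + b) (limit n)"
  proof (rule ex_uniform_shift)
    show "finite E" unfolding E_def using fin by (rule finite_imageI)
  next
    fix x assume x: "\<And>s. alive s x"
    obtain w where w: "x = str_num w" using bij_str_num by (metis bij_pointE)
    then have "w \<notin> A" using x alive_iff by blast
    have "ic_bar U w A \<le> enat (length w + 1) + enat d"
      using ic_le[of w] ic_bar_machine_le[OF \<open>w \<notin> A\<close>] by (meson add_right_mono order_trans)
    also have "\<dots> < enat (length w + d + 2)" by simp
    finally show "\<exists>k. eventually_cov k x" using ic_cov[OF \<open>w \<notin> A\<close>] w by blast
  next
    fix x k assume x: "x \<notin> E" "\<And>s. alive s x" "x \<in> described k"
    obtain w where w: "x = str_num w" using bij_str_num by (metis bij_pointE)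
    then have "w \<notin> A" using x alive_iff by blast
    have "ic_bar U w A + enat (d + 3) < KC U w"
      using x(1) w by (auto simp: E_def not_le)
    also have "\<dots> \<le> enat (k + 3) + enat d"
      using KC_le[of w] KC_machine_le[of w k] x(3) w by (meson add_right_mono order_trans)
    finally have "ic_bar U w A < enat k" by (cases "ic_bar U w A") auto
    then show "\<exists>l<k. eventually_cov l x" using ic_cov[OF \<open>w \<notin> A\<close>] w by blast
  qed
  then obtain b where b: "\<And>n. eventually_cov (n + b) (limit n)" by blast
  \<comment> \<open>The row of slots with the shift \<open>b\<close> just found is the array that
    contradicts hyperhypersimplicity.\<close>
  obtain h where h: "total_recursive h" "\<And>j. W (h j) = marked (prod_encode (b, j))"
    using ex_marking_array by blast
  have "finite (W (h j))" for j unfolding h by (rule finite_marked)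
  moreover have "W (h i) \<inter> W (h j) = {}" if "i \<noteq> j" for i j
    unfolding h using that by (intro marked_disjoint) (auto simp: prod_encode_eq)
  moreover have "W (h j) \<inter> - str_num ` A \<noteq> {}" for j
  proof -
    have "limit (prod_encode (b, j)) \<in> W (h j)"
      unfolding h by (rule limit_marked) (simp add: b)
    moreover have "limit (prod_encode (b, j)) \<notin> str_num ` A"
      using alive_all alive_limit by blast
    ultimately show ?thesis by blast
  qed
  ultimately show False using A h(1) unfolding hyperhypersimple_def by blast
qed

lemma ic_bar_le_ic: "ic_bar U x A \<le> ic U x A"
  unfolding ic_def ic_bar_def by (rule Inf_superset_mono) blast

theorem theorem4p6:
  fixes U :: mapping and A :: "bitstr set"
  assumes "optimal U"
    and "hyperhypersimple (str_num ` A)"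
  shows "(\<exists>c::nat. infinite {x. ic U x A + enat c \<ge> KC U x}) \<and>
         (\<exists>c'::nat. infinite {x. ic_bar U x A + enat c' \<ge> KC U x})"
proof
  show ic_bar: "\<exists>c::nat. infinite {x. ic_bar U x A + enat c \<ge> KC U x}"
    using hard_instances_ic_bar[OF assms] .
  have "{x. ic_bar U x A + enat c \<ge> KC U x} \<subseteq> {x. ic U x A + enat c \<ge> KC U x}" for c :: nat
    using ic_bar_le_ic by (meson Collect_mono add_right_mono order_trans)
  then show "\<exists>c::nat. infinite {x. ic U x A + enat c \<ge> KC U x}"
    using ic_bar finite_subset by blast
qed

end
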